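(* Let $P\subset\mathbb R^N$ be a full-dimensional lattice polytope satisfying the standing assumptions of the context, let $P_{\mathrm{surj}}$ be a $P$-surjective polytope and let $<$ be a total order on $\mathbb Z^N$ that is compatible with addition. Then the minimum distance of the code $\mathrm{PC}_P$ over $\mathbb F_q$ satisfies $$d(\mathrm{PC}_P)\ \ge\ \min_{m\in\mathrm{Red}_<(P)}\#\Big(\big(m+(P_{\mathrm{surj}}-P)\big)\cap\mathrm{Red}_<(P_{\mathrm{surj}})\Big).$$
   Context: Setting. $\mathbb F_q$ is the finite field with $q$ elements, $p$ its characteristic, $\overline{\mathbb F_q}$ an algebraic closure. $P\subset\mathbb R^N$ is a full-dimensional convex lattice polytope. Faces are nonempty; $Q\preceq P$ means $Q$ is a face of $P$ ($P$ itself included); $P(k)$ is the set of $k$-dimensional faces; the elements of $P(N-1)$ are the facets and $r=\#P(N-1)$. For a facet $F$, $u_F\in\mathbb Z^N$ is the shortest (primitive) inner normal vector of $F$ with integer coordinates. Standing assumptions: $P$ is simple (each vertex belongs to exactly $N$ facets), and for every vertex $v$ the determinant of the $N\times N$ matrix $A(v)$ whose rows are the vectors $u_F$, $F\ni v$, is coprime to $p$. Toric variety. Let $\mathcal Z\subset\overline{\mathbb F_q}^{\,r}$ (coordinates $x_F$ indexed by facets) be the common zero set of the monomials $\prod_{F\not\ni v}X_F$, $v\in P(0)$, and $G=\{(t_F)\in(\overline{\mathbb F_q}^* )^r:\prod_F t_F^{u_F^{(j)}}=1\ \forall j=1,\dots,N\}$, acting coordinatewise. The points of the toric variety $\mathbf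 X_P$ are the $G$-orbits in $\overline{\mathbb F_q}^{\,r}\setminus\mathcal Z$; a point is $\mathbb F_q$-rational if its orbit is stable under $\mathbf x\mapsto(x_F^q)_F$. For a face $Q$, $\mathbb T_Q\subset\mathbf X_P$ is the set of points whose coordinates satisfy $x_F=0$ exactly when $F\supseteq Q$; $\mathbf X_P$ is the disjoint union of the $\mathbb T_Q$. For a vertex $v$ of $Q$, a $v$-normalized representative of a point of $\mathbb T_Q$ is a tuple in its orbit with $x_F=1$ for all $F\not\ni v$ (and $x_F=0$ for $F\supseteq Q$); a normalized representative is a $v$-normalized one for some such $v$. Code. Let $\alpha_F\in\mathbb Z$ be such that $P=\{m\in\mathbb R^N:\langle m,u_F\rangle\ge-\alpha_F\ \forall F\}$ with each inequality tight on the facet $F$. For $m\in P\cap\mathbb Z^N$ put $\chi^{\langle m,P\rangle}=\prod_F X_F^{\langle m,u_F\rangle+\alpha_F}$, and let $L(D)$ be the $\mathbb F_q$-span of these monomials. Choose a set $\mathcal P$ of normalized representatives, one for each $\mathbb F_q$-rational point of $\mathbf X_P$, and let $n=\#\mathbf X_P(\mathbb F_q)$. Then $\mathrm{ev}_P:L(D)\to\mathbb F_q^n$, $f\mapsto(f(\mathbf x))_{\mathbf x\in\mathcal P}$ (convention $0^0=1$), and the projective toric code is $\mathrm{PC}_P=\mathrm{ev}_P(L(D))$. The minimum distance $d(\mathrm{PC}_P)$ is the minimum Hamming weight of a nonzero codeword. $P$-surjective polytope. A lattice polytope $P'$ is $P$-surjective if it has the same normal fan as $P$ (hence the same vectors $u_F$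 and the same variety $\mathbf X_P$; its code is obtained with the integers $\alpha'_F$ such that $P'=\{m:\langle m,u_F\rangle\ge-\alpha'_F\ \forall F\}$, tight), contains $P$, and satisfies $\mathrm{PC}_{P'}=\mathbb F_q^{\,\#\mathbf X_P(\mathbb F_q)}$. With $\alpha^{\mathrm{surj}}_F$ these integers for $P_{\mathrm{surj}}$, $P_{\mathrm{surj}}-P$ denotes the polytope of the difference of the associated divisors: $P_{\mathrm{surj}}-P=\{m\in\mathbb R^N:\langle m,u_F\rangle\ge-(\alpha^{\mathrm{surj}}_F-\alpha_F)\ \forall F\}$. Projective reduction with respect to an order. For a lattice polytope $P$ and a face $Q$, $Q^\circ$ is the set of points of $Q$ lying in no proper face of $Q$. On $P\cap\mathbb Z^N$, $m\sim_P m'$ iff there is a face $Q\preceq P$ with $m,m'\in Q^\circ$ and $m-m'\in(q-1)\mathbb Z^N$. $\mathrm{Red}_<(m,P)$ is the minimum, for $<$, of the lattice points of $P$ that are $\sim_P$-equivalent to $m$, and $\mathrm{Red}_<(P)=\{\mathrm{Red}_<(m,P):m\in P\cap\mathbb Z^N\}$. *)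

theory Defs
  imports
    "HOL-Analysis.Analysis"
    "HOL-Algebra.Algebraic_Closure_Type"
    "HOL-Library.Poly_Mapping"
begin

section \<open>Lattice polytopes\<close>

text \<open>The lattice is the type \<open>int ^ 'n\<close>, embedded in \<open>real ^ 'n\<close> by \<open>emb\<close>.\<close>

definition emb :: "int ^ 'n \<Rightarrow> real ^ 'n" where
  "emb m = (\<chi> i. real_of_int (m $ i))"

definition lattice_points :: "(real ^ 'n) set \<Rightarrow> (int ^ 'n) set" where
  "lattice_points P = {m. emb m \<in> P}"

definition lattice_polytope :: "(real ^ 'n) set \<Rightarrow> bool" where
  "lattice_polytope P \<longleftrightarrow> (\<exists>V. finite V \<and> P = convex hull (emb ` V))"

definition facets :: "(real ^ 'n) set \<Rightarrow> (real ^ 'n) set set" where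
  "facets P = {F. F facet_of P}"

definition is_primitive_normal :: "(real ^ 'n) set \<Rightarrow> (real ^ 'n) set \<Rightarrow> int ^ 'n \<Rightarrow> bool" where
  "is_primitive_normal P F u \<longleftrightarrow>
     Gcd (range (($) u)) = 1 \<and>
     (\<exists>c. P \<subseteq> {x. c \<le> emb u \<bullet> x} \<and> F = P \<inter> {x. emb u \<bullet> x = c})"

text \<open>For a facet of a full-dimensional lattice polytope there is exactly one such vector.\<close>

definition facet_normal :: "(real ^ 'n) set \<Rightarrow> (real ^ 'n) set \<Rightarrow> int ^ 'n" where
  "facet_normal P F = (THE u. is_primitive_normal P F u)"

definition simple_polytope :: "(real ^ 'n) set \<Rightarrow> bool" where
  "simple_polytope P \<longleftrightarrow>
     (\<forall>v. v extreme_point_of P \<longrightarrow> card {F \<in> facets P. v \<in> F} = CARD('n))"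

text \<open>The bijection \<open>b\<close> orders the rows of the matrix; it only affects the sign of the determinant.\<close>

definition vertex_dets_coprime :: "(real ^ 'n) set \<Rightarrow> nat \<Rightarrow> bool" where
  "vertex_dets_coprime P p \<longleftrightarrow>
     (\<forall>v b. v extreme_point_of P \<and> bij_betw b (UNIV :: 'n set) {F \<in> facets P. v \<in> F} \<longrightarrow>
        coprime (det (\<chi> i. facet_normal P (b i))) (int p))"

definition standing_assumptions :: "(real ^ 'n) set \<Rightarrow> nat \<Rightarrow> bool" where
  "standing_assumptions P p \<longleftrightarrow>
     lattice_polytope P \<and> aff_dim P = int CARD('n) \<and> simple_polytope P \<and> vertex_dets_coprime P p"

definition normal_cone :: "(real ^ 'n) set \<Rightarrow> (real ^ 'n) set \<Rightarrow> (real ^ 'n) set" where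
  "normal_cone P Q = {w. \<forall>x\<in>Q. \<forall>y\<in>P. w \<bullet> x \<le> w \<bullet> y}"

definition normal_fan :: "(real ^ 'n) set \<Rightarrow> (real ^ 'n) set set" where
  "normal_fan P = {normal_cone P Q | Q. Q face_of P \<and> Q \<noteq> {}}"

text \<open>
  \<open>support_numbers P P'\<close> is the tuple of the integers \<open>\<alpha>'\<^sub>F\<close> of a polytope \<open>P'\<close> having the same normal
  fan as \<open>P\<close>, indexed by the facets \<open>F\<close> of \<open>P\<close>. In particular \<open>support_numbers P P\<close> is \<open>(\<alpha>\<^sub>F)\<^sub>F\<close>.
\<close>

definition support_numbers ::
  "(real ^ 'n) set \<Rightarrow> (real ^ 'n) set \<Rightarrow> (real ^ 'n) set \<Rightarrow> int" where
  "support_numbers P P' = (THE \<alpha>. \<alpha> \<in> facets P \<rightarrow>\<^sub>E UNIV \<and>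
     P' = {m. \<forall>F\<in>facets P. emb (facet_normal P F) \<bullet> m \<ge> - real_of_int (\<alpha> F)} \<and>
     (\<forall>F\<in>facets P. \<exists>m\<in>P'. emb (facet_normal P F) \<bullet> m = - real_of_int (\<alpha> F)))"

text \<open>The polytope \<open>P' - P\<close> of the difference of the associated divisors.\<close>

definition difference_polytope :: "(real ^ 'n) set \<Rightarrow> (real ^ 'n) set \<Rightarrow> (real ^ 'n) set" where
  "difference_polytope P P' =
     {m. \<forall>F\<in>facets P. emb (facet_normal P F) \<bullet> m \<ge>
           - real_of_int (support_numbers P P' F - support_numbers P P F)}"


section \<open>The toric variety\<close>

text \<open>
  The finite field is a type \<open>'k\<close>, so \<open>q = CARD('k)\<close>. Tuples indexed by the facets of \<open>P\<close> are
  extensional functions on \<open>facets P\<close>, and points of the variety are orbits of such tuples.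
\<close>

type_synonym ('n, 'k) coords = "(real ^ 'n) set \<Rightarrow> 'k alg_closure"

definition irrelevant_locus :: "(real ^ 'n) set \<Rightarrow> ('n, 'k :: field) coords set" where
  "irrelevant_locus P = {x \<in> facets P \<rightarrow>\<^sub>E UNIV.
     \<forall>v. v extreme_point_of P \<longrightarrow> (\<Prod>F \<in> {F \<in> facets P. v \<notin> F}. x F) = 0}"

definition torus_group :: "(real ^ 'n) set \<Rightarrow> ('n, 'k :: field) coords set" where
  "torus_group P = {t \<in> facets P \<rightarrow>\<^sub>E (UNIV - {0}).
     \<forall>j. (\<Prod>F \<in> facets P. t F powi (facet_normal P F $ j)) = 1}"

definition group_orbit ::
  "(real ^ 'n) set \<Rightarrow> ('n, 'k :: field) coords \<Rightarrow> ('n, 'k) coords set" where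
  "group_orbit P x = {(\<lambda>F\<in>facets P. t F * x F) | t. t \<in> torus_group P}"

definition toric_variety :: "(real ^ 'n) set \<Rightarrow> ('n, 'k :: field) coords set set" where
  "toric_variety P = group_orbit P ` ((facets P \<rightarrow>\<^sub>E UNIV) - irrelevant_locus P)"

definition frobenius ::
  "(real ^ 'n) set \<Rightarrow> ('n, 'k :: {field, finite}) coords \<Rightarrow> ('n, 'k) coords" where
  "frobenius P x = (\<lambda>F\<in>facets P. x F ^ CARD('k))"

definition rational_points :: "(real ^ 'n) set \<Rightarrow> ('n, 'k :: {field, finite}) coords set set" where
  "rational_points P = {pt \<in> toric_variety P. frobenius P ` pt \<subseteq> pt}"

definition torus_stratum ::
  "(real ^ 'n) set \<Rightarrow> (real ^ 'n) set \<Rightarrow> ('n, 'k :: field) coords set set" where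
  "torus_stratum P Q = {pt \<in> toric_variety P. \<forall>x\<in>pt. \<forall>F\<in>facets P. x F = 0 \<longleftrightarrow> Q \<subseteq> F}"

definition normalized_rep ::
  "(real ^ 'n) set \<Rightarrow> ('n, 'k :: field) coords set \<Rightarrow> ('n, 'k) coords \<Rightarrow> bool" where
  "normalized_rep P pt x \<longleftrightarrow> x \<in> pt \<and>
     (\<exists>Q v. Q face_of P \<and> Q \<noteq> {} \<and> pt \<in> torus_stratum P Q \<and> v extreme_point_of Q \<and>
        (\<forall>F\<in>facets P. (v \<notin> F \<longrightarrow> x F = 1) \<and> (Q \<subseteq> F \<longrightarrow> x F = 0)))"

text \<open>\<open>R\<close> consists of exactly one normalized representative for each rational point.\<close>

definition is_rep_set ::
  "(real ^ 'n) set \<Rightarrow> ('n, 'k :: {field, finite}) coords set \<Rightarrow> bool" where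
  "is_rep_set P R \<longleftrightarrow>
     (\<forall>x\<in>R. \<exists>pt\<in>rational_points P. normalized_rep P pt x) \<and>
     (\<forall>pt\<in>rational_points P. \<exists>!x. x \<in> R \<and> x \<in> pt)"


section \<open>Projective toric codes\<close>

text \<open>Polynomials in the variables \<open>X\<^sub>F\<close>: finitely supported maps from exponents to coefficients.\<close>

type_synonym ('n, 'k) cox_poly = "((real ^ 'n) set \<Rightarrow>\<^sub>0 nat) \<Rightarrow>\<^sub>0 'k"

definition eval_poly ::
  "(real ^ 'n) set \<Rightarrow> ('n, 'k :: field) cox_poly \<Rightarrow> ('n, 'k) coords \<Rightarrow> 'k alg_closure" where
  "eval_poly P f x = (\<Sum>e \<in> Poly_Mapping.keys f.
     to_ac (Poly_Mapping.lookup f e) * (\<Prod>F \<in> facets P. x F ^ Poly_Mapping.lookup e F))"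

text \<open>
  The exponent of the monomial of \<open>m\<close> with respect to \<open>P'\<close>; the truncation by \<open>nat\<close>
  has no effect for lattice points \<open>m\<close> of \<open>P'\<close>.
\<close>

definition monomial_exponent ::
  "(real ^ 'n) set \<Rightarrow> (real ^ 'n) set \<Rightarrow> int ^ 'n \<Rightarrow> ((real ^ 'n) set \<Rightarrow>\<^sub>0 nat)" where
  "monomial_exponent P P' m = (\<Sum>F \<in> facets P. Poly_Mapping.single F
     (nat ((\<Sum>i\<in>UNIV. m $ i * facet_normal P F $ i) + support_numbers P P' F)))"

definition section_space ::
  "(real ^ 'n) set \<Rightarrow> (real ^ 'n) set \<Rightarrow> ('n, 'k :: field) cox_poly set" where
  "section_space P P' =
     {\<Sum>m \<in> lattice_points P'. Poly_Mapping.single (monomial_exponent P P' m) (c m) | c. True}"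

text \<open>
  Words of length \<open>n\<close> over \<open>'k\<close> are extensional functions on the set \<open>R\<close> of representatives of the
  rational points. Sections take values in \<open>range to_ac\<close> on \<open>R\<close>, so \<open>of_ac\<close> only identifies
  this range with \<open>'k\<close>.
\<close>

definition evaluation ::
  "(real ^ 'n) set \<Rightarrow> ('n, 'k :: field) coords set \<Rightarrow> ('n, 'k) cox_poly \<Rightarrow>
     (('n, 'k) coords \<Rightarrow> 'k)" where
  "evaluation P R f = (\<lambda>x\<in>R. of_ac (eval_poly P f x))"

text \<open>
  \<open>toric_code P P' R\<close> is the code of \<open>P'\<close> on the variety of \<open>P\<close>, for \<open>P'\<close> with the same normal fan
  as \<open>P\<close>; the code of \<open>P\<close> itself is \<open>toric_code P P R\<close>.
\<close>

definition toric_code ::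
  "(real ^ 'n) set \<Rightarrow> (real ^ 'n) set \<Rightarrow> ('n, 'k :: field) coords set \<Rightarrow>
     (('n, 'k) coords \<Rightarrow> 'k) set" where
  "toric_code P P' R = evaluation P R ` section_space P P'"

definition hamming_weight :: "'b set \<Rightarrow> ('b \<Rightarrow> 'k :: zero) \<Rightarrow> nat" where
  "hamming_weight R c = card {x \<in> R. c x \<noteq> 0}"

definition minimum_distance :: "'b set \<Rightarrow> ('b \<Rightarrow> 'k :: zero) set \<Rightarrow> nat" where
  "minimum_distance R C = Min (hamming_weight R ` (C - {\<lambda>x\<in>R. 0}))"

definition surjective_polytope ::
  "(real ^ 'n) set \<Rightarrow> ('n, 'k :: field) coords set \<Rightarrow> (real ^ 'n) set \<Rightarrow> bool" where
  "surjective_polytope P R P' \<longleftrightarrow>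
     lattice_polytope P' \<and> normal_fan P' = normal_fan P \<and> P \<subseteq> P' \<and>
     toric_code P P' R = (R \<rightarrow>\<^sub>E UNIV)"


section \<open>Projective reduction\<close>

definition additive_total_order :: "('b :: ab_group_add \<Rightarrow> 'b \<Rightarrow> bool) \<Rightarrow> bool" where
  "additive_total_order lt \<longleftrightarrow>
     irreflp lt \<and> transp lt \<and> totalp lt \<and> (\<forall>a b c. lt a b \<longrightarrow> lt (a + c) (b + c))"

definition face_interior :: "(real ^ 'n) set \<Rightarrow> (real ^ 'n) set" where
  "face_interior Q = Q - \<Union>{Q'. Q' face_of Q \<and> Q' \<noteq> Q}"

definition red_equiv :: "nat \<Rightarrow> (real ^ 'n) set \<Rightarrow> int ^ 'n \<Rightarrow> int ^ 'n \<Rightarrow> bool" where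
  "red_equiv q P m m' \<longleftrightarrow>
     (\<exists>Q. Q face_of P \<and> Q \<noteq> {} \<and> emb m \<in> face_interior Q \<and> emb m' \<in> face_interior Q) \<and>
     (\<forall>i. (int q - 1) dvd (m $ i - m' $ i))"

definition red_point ::
  "nat \<Rightarrow> (int ^ 'n \<Rightarrow> int ^ 'n \<Rightarrow> bool) \<Rightarrow> (real ^ 'n) set \<Rightarrow> int ^ 'n \<Rightarrow> int ^ 'n" where
  "red_point q lt P m = (THE a. a \<in> lattice_points P \<and> red_equiv q P m a \<and>
     (\<forall>b\<in>lattice_points P. red_equiv q P m b \<and> b \<noteq> a \<longrightarrow> lt a b))"

definition red_set ::
  "nat \<Rightarrow> (int ^ 'n \<Rightarrow> int ^ 'n \<Rightarrow> bool) \<Rightarrow> (real ^ 'n) set \<Rightarrow> (int ^ 'n) set" where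
  "red_set q lt P = red_point q lt P ` lattice_points P"

end

(*
  A codeword is f = sum of c_m chi^m over reduced m; let m0 be the largest m occurring. For a reduced k
  of the big polytope with k - m0 in the difference polytope, the product f chi^(k - m0) is a section of
  the big polytope with leading monomial k, and reduction only lowers the other monomials. Since reduced
  monomials are linearly independent as functions on the rational points, these products are independent;
  being multiples of f they live on the support of the codeword, so there are at most wt(f) of them.

  Independence: for a face and a vertex v of it, every y in (F_q^* )^N is the image of a rational point
  vanishing exactly on the facets through the face, where chi^m becomes a constant times y^(m - v) for m
  in the face and 0 otherwise. Distinct exponents modulo q - 1 give distinct characters of (F_q^* )^N.
*)
theory Submission
  imports Defs
begin

text \<open>The matrices A(v) are invertible over the rationals, not always over the integers, so
  the coordinates of a normalized representative need not lie in F_q. What rationality provides is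
  x^q = t x with t in G, and every character t -> prod_F t_F^<m,u_F> is trivial on G. Both facts
  about monomials come from this: their values at the representatives lie in F_q, and equivalent
  lattice points give the same function.

  The big polytope has to be handled through the facets of the small one. Equality of the normal
  fans serves this purpose: it lets integers indexed by the facets of P cut out the big polytope,
  and it puts the facets of P that are tight at one of its lattice points at a common vertex of P.
  Faces and their interiors can then be replaced by sets of tight facets.

  For the count, a surplus of products over points of the support would give a nontrivial relation
  among them on all of R. The leading term of the product with the largest k cannot cancel in it,
  because every other term has a strictly smaller exponent.\<close>

no_notation fps_nth (infixl \<open>$\<close> 75)

section \<open>Integer matrices and the lattice\<close>

lemma clear_denominators:
  fixes f :: "'a \<Rightarrow> rat"
  assumes "finite A"
  shows "\<exists>d>0. \<forall>a\<in>A. \<exists>z. of_int d * f a = of_int z"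
  using assms
proof (induction A)
  case empty
  then show ?case by (auto intro: exI[of _ 1])
next
  case (insert a A)
  then obtain d where d: "d > 0" "\<forall>a\<in>A. \<exists>z. of_int d * f a = of_int z" by blast
  obtain p r where pr: "quotient_of (f a) = (p, r)" by (cases "quotient_of (f a)")
  have r: "r > 0" and fa: "f a = of_int p / of_int r"
    using quotient_of_denom_pos[OF pr] quotient_of_div[OF pr] by auto
  have "\<exists>z. of_int (r * d) * f a = of_int z"
    by (rule exI[of _ "d * p"]) (use r fa in simp)
  moreover have "\<exists>z. of_int (r * d) * f b = of_int z" if "b \<in> A" for b
  proof -
    obtain z where "of_int d * f b = of_int z"
      using d(2) \<open>b \<in> A\<close> by auto
    then have "of_int (r * d) * f b = of_int (r * z)" by (simp add: mult.assoc)
    then show ?thesis by blast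
  qed
  ultimately show ?case using r d(1) by (intro exI[of _ "r * d"]) auto
qed

text \<open>The determinant is unchanged over the rationals, so a rational kernel vector exists; a
  common denominator makes it integral.\<close>

lemma singular_int_matrix_kernel:
  fixes A :: "int ^ 'n ^ 'n"
  assumes "det A = 0"
  shows "\<exists>u. u \<noteq> 0 \<and> A *v u = 0"
proof -
  define A' :: "rat ^ 'n ^ 'n" where "A' = (\<chi> i j. of_int (A $ i $ j))"
  have "det A' = of_int (det A)"
    by (simp add: A'_def det_def)
  then have "\<not> invertible A'"
    using assms by (simp add: invertible_det_nz)
  then obtain x where x: "A' *v x = 0" "x \<noteq> 0"
    by (meson matrix_left_invertible_ker invertible_left_inverse)
  obtain d :: int where d: "d > 0" "\<forall>i. \<exists>z. of_int d * x $ i = of_int z"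
    using clear_denominators[of UNIV "($) x"] by auto
  then obtain u where u: "\<And>i. of_int d * x $ i = of_int (u i)" by metis
  let ?u = "\<chi> i. u i"
  have "of_int ((A *v ?u) $ i) = (0::rat)" for i
  proof -
    have "of_int ((A *v ?u) $ i) = (\<Sum>j\<in>UNIV. of_int (A $ i $ j) * (of_int d * x $ j))"
      by (simp add: matrix_vector_mult_def u)
    also have "\<dots> = of_int d * (A' *v x) $ i"
      by (simp add: matrix_vector_mult_def A'_def sum_distrib_left mult_ac)
    finally show ?thesis by (simp add: x)
  qed
  then have "A *v ?u = 0" by (simp add: vec_eq_iff)
  moreover obtain i where "x $ i \<noteq> 0" using x(2) by (auto simp: vec_eq_iff)
  then have "?u \<noteq> 0" using u[of i] d(1) by (auto simp: vec_eq_iff intro!: exI[of _ i])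
  ultimately show ?thesis by blast
qed

text \<open>\<open>B\<close> is the rational inverse with denominators cleared. Its entries are used
  later as lattice vectors dual to the normals at a vertex and as exponents of field elements, which
  is why they must be integers.\<close>

lemma nonsingular_int_matrix_scaled_inverse:
  fixes A :: "int ^ 'n ^ 'n"
  assumes "det A \<noteq> 0"
  shows "\<exists>B d. d > 0 \<and> B ** A = mat d \<and> A ** B = mat d"
proof -
  define A' :: "rat ^ 'n ^ 'n" where "A' = (\<chi> i j. of_int (A $ i $ j))"
  have "det A' = of_int (det A)"
    by (simp add: A'_def det_def)
  then have "invertible A'"
    using assms by (simp add: invertible_det_nz)
  then obtain B' where B': "B' ** A' = mat 1" "A' ** B' = mat 1"
    by (auto simp: invertible_def)
  obtain d :: int where d: "d > 0" "\<And>i j. \<exists>z. of_int d * B' $ i $ j = of_int z"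
    using clear_denominators[of UNIV "\<lambda>(i, j). B' $ i $ j"] by auto
  then obtain B where B: "\<And>i j. of_int d * B' $ i $ j = of_int (B i j)" by metis
  let ?B = "\<chi> i j. B i j"
  have "of_int ((?B ** A) $ i $ j) = (of_int (mat d $ i $ j) :: rat)" for i j
  proof -
    have "of_int ((?B ** A) $ i $ j) = (\<Sum>k\<in>UNIV. (of_int d * B' $ i $ k) * of_int (A $ k $ j))"
      by (simp add: matrix_matrix_mult_def B)
    also have "\<dots> = of_int d * (B' ** A') $ i $ j"
      by (simp add: matrix_matrix_mult_def A'_def sum_distrib_left mult_ac)
    finally show ?thesis by (simp add: B' mat_def)
  qed
  then have "?B ** A = mat d" by (simp add: vec_eq_iff)
  moreover have "of_int ((A ** ?B) $ i $ j) = (of_int (mat d $ i $ j) :: rat)" for i j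
  proof -
    have "of_int ((A ** ?B) $ i $ j) = (\<Sum>k\<in>UNIV. of_int (A $ i $ k) * (of_int d * B' $ k $ j))"
      by (simp add: matrix_matrix_mult_def B)
    also have "\<dots> = of_int d * (A' ** B') $ i $ j"
      by (simp add: matrix_matrix_mult_def A'_def sum_distrib_left mult_ac)
    finally show ?thesis by (simp add: B' mat_def)
  qed
  then have "A ** ?B = mat d" by (simp add: vec_eq_iff)
  ultimately show ?thesis using d(1) by blast
qed

section \<open>The integer pairing and lattice points of polytopes\<close>

definition pairing :: "int ^ 'n \<Rightarrow> int ^ 'n \<Rightarrow> int" where
  "pairing m u = (\<Sum>i\<in>UNIV. m $ i * u $ i)"

lemma emb_inner_emb: "emb u \<bullet> emb m = real_of_int (pairing m u)"
  by (simp add: emb_def inner_vec_def pairing_def mult.commute)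

lemma pairing_add: "pairing (m + m') u = pairing m u + pairing m' u"
  by (simp add: pairing_def algebra_simps sum.distrib)

lemma pairing_diff: "pairing (m - m') u = pairing m u - pairing m' u"
  by (simp add: pairing_def algebra_simps sum_subtractf)

lemma emb_eq_iff [simp]: "emb u = emb v \<longleftrightarrow> u = v"
  by (simp add: emb_def vec_eq_iff)

lemma emb_0 [simp]: "emb 0 = 0"
  by (simp add: emb_def vec_eq_iff)

lemma emb_diff: "emb (u - v) = emb u - emb v"
  by (simp add: emb_def vec_eq_iff)

lemma emb_uminus: "emb (- u) = - emb u"
  by (simp add: emb_def vec_eq_iff)

lemma polytope_lattice_polytope: "lattice_polytope P \<Longrightarrow> polytope P"
  unfolding lattice_polytope_def using polytope_convex_hull by blast

lemma extreme_point_lattice_polytope: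
  assumes "lattice_polytope P" "v extreme_point_of P"
  shows "\<exists>m. v = emb m"
  using assms extreme_point_of_convex_hull unfolding lattice_polytope_def by blast

lemma face_has_extreme_point:
  fixes P :: "'a :: euclidean_space set"
  assumes "polytope P" "Q face_of P" "Q \<noteq> {}"
  shows "\<exists>v. v extreme_point_of Q \<and> v extreme_point_of P"
proof -
  have "polytope Q" by (rule face_of_polytope_polytope[OF assms(1,2)])
  then obtain v where "v extreme_point_of Q"
    using extreme_point_exists_convex[of Q] assms(3) polytope_imp_compact polytope_imp_convex by blast
  then show ?thesis using assms(2) extreme_point_of_face by blast
qed

lemma finite_lattice_points:
  assumes "bounded P"
  shows "finite (lattice_points P)"
proof -
  obtain B where B: "\<And>x. x \<in> P \<Longrightarrow> norm x \<le> B" using assms bounded_iff by blast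
  have "lattice_points P \<subseteq> vec_lambda ` (UNIV \<rightarrow>\<^sub>E {- \<lceil>B\<rceil>..\<lceil>B\<rceil>})"
  proof
    fix m assume "m \<in> lattice_points P"
    then have "norm (emb m) \<le> B" using B by (auto simp: lattice_points_def)
    then have "\<bar>emb m $ i\<bar> \<le> B" for i
      using component_le_norm_cart order_trans by blast
    then have "\<bar>real_of_int (m $ i)\<bar> \<le> B" for i by (simp add: emb_def)
    then have "\<bar>m $ i\<bar> \<le> \<lceil>B\<rceil>" for i
      by (metis le_of_int_ceiling of_int_abs of_int_le_iff order_trans)
    then have "m $ i \<in> {- \<lceil>B\<rceil>..\<lceil>B\<rceil>}" for i
      by (simp add: abs_le_iff minus_le_iff)
    then have "($) m \<in> UNIV \<rightarrow>\<^sub>E {- \<lceil>B\<rceil>..\<lceil>B\<rceil>}" by auto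
    then show "m \<in> vec_lambda ` (UNIV \<rightarrow>\<^sub>E {- \<lceil>B\<rceil>..\<lceil>B\<rceil>})"
      by (metis image_eqI vec_nth_inverse)
  qed
  moreover have "finite (vec_lambda ` (UNIV \<rightarrow>\<^sub>E {- \<lceil>B\<rceil>..\<lceil>B\<rceil>}) :: (int ^ 'a) set)"
    by (intro finite_imageI finite_PiE) auto
  ultimately show ?thesis using finite_subset by blast
qed

text \<open>A basis of the span taken from \<open>D\<close> has fewer than N vectors. Placed in the
  rows of a square matrix with at least one row left zero, it gives a singular integer matrix whose
  kernel supplies \<open>u\<close>.\<close>

lemma int_orthogonal_vector:
  fixes D :: "(int ^ 'n) set"
  assumes "dim (emb ` D) < CARD('n)"
  shows "\<exists>u. u \<noteq> 0 \<and> (\<forall>d\<in>D. emb u \<bullet> emb d = 0)"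
proof -
  obtain B where B: "B \<subseteq> emb ` D" "independent B" "emb ` D \<subseteq> span B" "card B = dim (emb ` D)"
    using basis_exists by blast
  have finB: "finite B" using B(2) independent_bound by blast
  obtain E where E: "E \<subseteq> D" "B = emb ` E" "inj_on emb E"
    using B(1) by (metis subset_image_inj)
  have finE: "finite E" using finB E finite_imageD by blast
  have cE: "card E < CARD('n)" using E B(4) assms by (simp add: card_image)
  obtain g :: "int ^ 'n \<Rightarrow> 'n" where g: "inj_on g E"
    using card_le_inj[OF finE, of "UNIV :: 'n set"] cE by auto
  obtain i0 where i0: "i0 \<notin> g ` E"
    using cE g by (metis UNIV_eq_I card_image less_irrefl)
  define A :: "int ^ 'n ^ 'n" where
    "A = (\<chi> i. if i \<in> g ` E then the_inv_into E g i else 0)"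
  have "det A = 0" by (rule det_zero_row[of i0]) (simp add: A_def i0 row_def vec_eq_iff)
  then obtain u where u: "u \<noteq> 0" "A *v u = 0" using singular_int_matrix_kernel by blast
  have "emb u \<bullet> emb d = 0" if "d \<in> E" for d
  proof -
    have "A $ g d = d" using that g by (simp add: A_def the_inv_into_f_f)
    then have "(A *v u) $ g d = pairing d u"
      by (simp add: matrix_vector_mult_def pairing_def)
    then show ?thesis using u(2) by (simp add: emb_inner_emb)
  qed
  then have "B \<subseteq> {x. emb u \<bullet> x = 0}" using E by auto
  then have "span B \<subseteq> {x. emb u \<bullet> x = 0}" using span_minimal subspace_hyperplane by blast
  then show ?thesis using B(3) u(1) by blast
qed

section \<open>Primitive facet normals\<close>

text \<open>Being orthogonal to \<open>S\<close>, the vector \<open>a\<close> lies outside its span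
  and completes it to the whole space. The part of \<open>u\<close> orthogonal to \<open>a\<close>
  is then orthogonal to everything.\<close>

lemma orthogonal_to_hyperplane_unique:
  fixes a u :: "'a :: euclidean_space"
  assumes "Suc (dim S) = DIM('a)" "a \<noteq> 0"
    and "\<And>s. s \<in> S \<Longrightarrow> a \<bullet> s = 0" "\<And>s. s \<in> S \<Longrightarrow> u \<bullet> s = 0"
  shows "\<exists>c. u = c *\<^sub>R a"
proof -
  have "span S \<subseteq> {x. a \<bullet> x = 0}"
    using assms(3) by (intro span_minimal) (auto simp: subspace_hyperplane)
  then have "a \<notin> span S" using assms(2) by auto
  then have "dim (insert a S) = DIM('a)" using assms(1) by (simp add: dim_insert)
  then have full: "span (insert a S) = UNIV" by (simp add: dim_eq_full)
  define w where "w = u - ((u \<bullet> a) / (a \<bullet> a)) *\<^sub>R a"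
  have "w \<bullet> a = 0" using assms(2) by (simp add: w_def inner_diff_left)
  moreover have "w \<bullet> s = 0" if "s \<in> S" for s
    using assms(3,4)[OF that] by (simp add: w_def inner_diff_left)
  ultimately have "span (insert a S) \<subseteq> {x. w \<bullet> x = 0}"
    by (intro span_minimal) (auto simp: subspace_hyperplane)
  then have "w \<in> {x. w \<bullet> x = 0}" unfolding full by blast
  then have "w = 0" by simp
  then show ?thesis by (auto simp: w_def)
qed

lemma exists_primitive_multiple:
  fixes u :: "int ^ 'n"
  assumes "u \<noteq> 0"
  shows "\<exists>w g. g > 0 \<and> Gcd (range (($) w)) = 1 \<and> emb u = of_int g *\<^sub>R emb w"
proof -
  define g where "g = Gcd (range (($) u))"
  obtain i where i: "u $ i \<noteq> 0" using assms by (auto simp: vec_eq_iff)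
  have "g \<noteq> 0" using i by (auto simp: g_def)
  moreover have "g \<ge> 0" by (simp add: g_def)
  ultimately have g: "g > 0" by simp
  define w where "w = (\<chi> i. u $ i div g)"
  have uw: "u $ i = g * w $ i" for i
    by (simp add: w_def g_def)
  have "range (($) u) = (*) g ` range (($) w)" using uw by (auto simp: image_iff)
  moreover have "g = Gcd (range (($) u))" by (simp add: g_def)
  ultimately have "g = g * Gcd (range (($) w))"
    using Gcd_mult[of g "range (($) w)"] g by (simp add: normalize_mult)
  then have "Gcd (range (($) w)) = 1" using g by simp
  moreover have "emb u = of_int g *\<^sub>R emb w" by (simp add: emb_def vec_eq_iff uw)
  ultimately show ?thesis using g by blast
qed

text \<open>A coordinate with u_i nonzero gives the integer identity |u_i| w = |w_i| u, where the
  absolute values rely on \<open>k\<close> being positive. Taking gcds on both sides yields |u_i| =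
  |w_i|.\<close>

lemma primitive_parallel_eq:
  fixes u w :: "int ^ 'n"
  assumes "Gcd (range (($) u)) = 1" "Gcd (range (($) w)) = 1" "emb w = k *\<^sub>R emb u" "k > 0"
  shows "u = w"
proof -
  have "u \<noteq> 0" using assms(1) by (auto simp: Gcd_0_iff)
  then obtain i where i: "u $ i \<noteq> 0" by (auto simp: vec_eq_iff)
  have k: "real_of_int (w $ j) = k * real_of_int (u $ j)" for j
    using arg_cong[OF assms(3), of "\<lambda>x. x $ j"] by (simp add: emb_def)
  have "real_of_int (\<bar>u $ i\<bar> * w $ j) = real_of_int (\<bar>w $ i\<bar> * u $ j)" for j
    using assms(4) by (simp add: k abs_mult)
  then have eq: "\<bar>u $ i\<bar> * w $ j = \<bar>w $ i\<bar> * u $ j" for j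
    using of_int_eq_iff by blast
  then have "(*) \<bar>u $ i\<bar> ` range (($) w) = (*) \<bar>w $ i\<bar> ` range (($) u)" by (auto simp: image_iff)
  then have "\<bar>u $ i\<bar> = \<bar>w $ i\<bar>"
    using Gcd_mult[of "\<bar>u $ i\<bar>" "range (($) w)"] Gcd_mult[of "\<bar>w $ i\<bar>" "range (($) u)"] assms(1,2)
    by simp
  then have "w $ j = u $ j" for j using eq[of j] i by (metis abs_eq_0 mult_cancel_left)
  then show ?thesis by (simp add: vec_eq_iff)
qed

lemma dim_translated:
  fixes F :: "'a :: euclidean_space set"
  assumes "p \<in> F" "aff_dim F = int DIM('a) - 1"
  shows "Suc (dim ((\<lambda>x. x - p) ` F)) = DIM('a)"
proof -
  have "aff_dim F = int (dim ((+) (- p) ` F))"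
    using assms(1) hull_subset by (intro aff_dim_eq_dim) fastforce
  moreover have "(+) (- p) ` F = (\<lambda>x. x - p) ` F" by auto
  ultimately show ?thesis using assms(2) by simp
qed

text \<open>Polyhedral theory yields only a real normal \<open>a\<close>. The facet is a hull of
  lattice points, so its directions are spanned by lattice vectors and admit an integral orthogonal
  vector, which must be parallel to \<open>a\<close>.\<close>

lemma facet_has_primitive_normal:
  fixes P :: "(real ^ 'n) set"
  assumes "lattice_polytope P" "aff_dim P = int CARD('n)" "F \<in> facets P"
  shows "\<exists>u. is_primitive_normal P F u"
proof -
  have fac: "F facet_of P" "F face_of P" "F \<noteq> {}" "aff_dim F = int CARD('n) - 1"
    using assms(2,3) by (auto simp: facets_def facet_of_def)
  obtain a b where ab: "a \<noteq> 0" "P \<subseteq> {x. a \<bullet> x \<le> b}" "F = P \<inter> {x. a \<bullet> x = b}"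
    using facet_of_polyhedron[OF polytope_imp_polyhedron[OF polytope_lattice_polytope[OF assms(1)]] fac(1)]
    by metis
  obtain V where V: "finite V" "P = convex hull (emb ` V)"
    using assms(1) lattice_polytope_def by blast
  obtain S' where S': "S' \<subseteq> emb ` V" "F = convex hull S'"
    using face_of_convex_hull_subset[of "emb ` V" F] fac(2) finite_imp_compact[OF finite_imageI[OF V(1)]]
    unfolding V(2) by blast
  obtain W where W: "W \<subseteq> V" "S' = emb ` W" using S'(1) by (auto simp: subset_image_iff)
  obtain p where p: "p \<in> W" using fac(3) S' W by (cases "W = {}") auto
  have WF: "emb m \<in> F" if "m \<in> W" for m using that hull_inc[of "emb m" S' convex] unfolding S'(2) W(2) by simp
  have "aff_dim (emb ` W) = int CARD('n) - 1" 
    using fac(4) unfolding S'(2) W(2) by (simp only: aff_dim_convex_hull)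
  then have dimW: "Suc (dim ((\<lambda>x. x - emb p) ` emb ` W)) = CARD('n)"
    using dim_translated[of "emb p" "emb ` W"] p by simp
  define D where "D = (\<lambda>m. m - p) ` W"
  have embD: "emb ` D = (\<lambda>x. x - emb p) ` emb ` W" by (auto simp: D_def emb_diff image_image)
  obtain u where u: "u \<noteq> 0" "\<forall>d\<in>D. emb u \<bullet> emb d = 0"
    using int_orthogonal_vector[of D] dimW unfolding embD by auto
  have aW: "a \<bullet> s = 0" if "s \<in> emb ` D" for s
    using that p WF ab(3) by (auto simp: embD inner_diff_right)
  obtain c where c: "emb u = c *\<^sub>R a"
    using orthogonal_to_hyperplane_unique[of "emb ` D" a "emb u"] dimW ab(1) aW u(2)
    unfolding embD[symmetric] by auto
  have "c \<noteq> 0" using u(1) c by (metis emb_0 emb_eq_iff scale_eq_0_iff)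
  \<comment> \<open>The hyperplane with normal \<open>a\<close> bounds \<open>P\<close> from above,
    whereas an inner normal bounds it from below; hence the negative multiple.\<close>
  obtain u' c' where u': "u' \<noteq> 0" "emb u' = c' *\<^sub>R a" "c' < 0"
  proof (cases "c < 0")
    case True then show ?thesis using that u c by blast
  next
    case False then show ?thesis using that[of "- u" "- c"] u c \<open>c \<noteq> 0\<close> by (simp add: emb_uminus)
  qed
  obtain w g where w: "g > 0" "Gcd (range (($) w)) = 1" "emb u' = of_int g *\<^sub>R emb w"
    using exists_primitive_multiple[OF u'(1)] by blast
  define k where "k = c' / of_int g"
  have k: "k < 0" "emb w = k *\<^sub>R a"
  proof -
    show "k < 0" using u' w by (simp add: k_def divide_neg_pos)
    have "emb w = (1 / of_int g) *\<^sub>R (of_int g *\<^sub>R emb w)" using w(1) by simp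
    also have "\<dots> = k *\<^sub>R a" unfolding w(3)[symmetric] u'(2) by (simp add: k_def)
    finally show "emb w = k *\<^sub>R a" .
  qed
  have "P \<subseteq> {x. k * b \<le> emb w \<bullet> x}" using ab(2) k by auto
  moreover have "F = P \<inter> {x. emb w \<bullet> x = k * b}" using ab(3) k by auto
  ultimately show ?thesis using w(2) unfolding is_primitive_normal_def by blast
qed

text \<open>Both vectors are orthogonal to the directions of \<open>F\<close>, hence parallel. A
  point of \<open>P\<close> off \<open>F\<close> shows that the factor is positive.\<close>

lemma primitive_normal_unique:
  fixes P :: "(real ^ 'n) set"
  assumes "aff_dim P = int CARD('n)" "F \<in> facets P"
    and "is_primitive_normal P F u" "is_primitive_normal P F w"
  shows "u = w"
proof -
  have fac: "F \<noteq> {}" "aff_dim F = int CARD('n) - 1"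
    using assms(1,2) by (auto simp: facets_def facet_of_def)
  obtain c where c: "Gcd (range (($) u)) = 1" "P \<subseteq> {x. c \<le> emb u \<bullet> x}" "F = P \<inter> {x. emb u \<bullet> x = c}"
    using assms(3) unfolding is_primitive_normal_def by blast
  obtain d where d: "Gcd (range (($) w)) = 1" "P \<subseteq> {x. d \<le> emb w \<bullet> x}" "F = P \<inter> {x. emb w \<bullet> x = d}"
    using assms(4) unfolding is_primitive_normal_def by blast
  obtain p where p: "p \<in> F" using fac by blast
  have "u \<noteq> 0" using c(1) by (auto simp: Gcd_0_iff)
  then have "emb u \<noteq> 0" by (metis emb_0 emb_eq_iff)
  moreover have "emb u \<bullet> s = 0" "emb w \<bullet> s = 0" if "s \<in> (\<lambda>x. x - p) ` F" for s
  proof -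
    obtain y where y: "y \<in> F" "s = y - p" using \<open>s \<in> _\<close> by blast
    show "emb u \<bullet> s = 0" using y p unfolding c(3) by (simp add: inner_diff_right)
    show "emb w \<bullet> s = 0" using y p unfolding d(3) by (simp add: inner_diff_right)
  qed
  ultimately obtain k where k: "emb w = k *\<^sub>R emb u"
    using orthogonal_to_hyperplane_unique[of "(\<lambda>x. x - p) ` F" "emb u" "emb w"]
      dim_translated[OF p] fac(2) by auto
  have "F \<noteq> P" using assms(1) fac(2) by auto
  then obtain x where x: "x \<in> P" "x \<notin> F" using c(3) by blast
  have "emb u \<bullet> (x - p) > 0"
  proof -
    have "c \<le> emb u \<bullet> x" "emb u \<bullet> x \<noteq> c" "emb u \<bullet> p = c" using x p c(2,3) by auto
    then show ?thesis by (simp add: inner_diff_right)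
  qed
  moreover have "k * (emb u \<bullet> (x - p)) > 0"
  proof -
    have "d \<le> emb w \<bullet> x" "emb w \<bullet> x \<noteq> d" "emb w \<bullet> p = d" using x p d(2,3) by auto
    then have "emb w \<bullet> (x - p) > 0" by (simp add: inner_diff_right)
    then show ?thesis by (simp add: k)
  qed
  ultimately have "k > 0" by (simp add: zero_less_mult_iff)
  then show ?thesis using primitive_parallel_eq c(1) d(1) k by blast
qed

lemma facet_normal_is_primitive_normal:
  fixes P :: "(real ^ 'n) set"
  assumes "lattice_polytope P" "aff_dim P = int CARD('n)" "F \<in> facets P"
  shows "is_primitive_normal P F (facet_normal P F)"
  unfolding facet_normal_def
  by (rule theI'[OF ex_ex1I[OF facet_has_primitive_normal[OF assms] primitive_normal_unique[OF assms(2,3)]]])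

text \<open>Eliminating the constant of the hyperplane turns membership in a facet into minimality
  of its normal, the language of normal cones: a point v of \<open>P\<close> lies in
  \<open>F\<close> iff the normal of \<open>F\<close> lies in the cone of v.\<close>

lemma facet_mem_iff:
  fixes P :: "(real ^ 'n) set"
  assumes "lattice_polytope P" "aff_dim P = int CARD('n)" "F \<in> facets P"
  shows "x \<in> F \<longleftrightarrow> x \<in> P \<and> (\<forall>y\<in>P. emb (facet_normal P F) \<bullet> x \<le> emb (facet_normal P F) \<bullet> y)"
proof -
  obtain c where c: "P \<subseteq> {x. c \<le> emb (facet_normal P F) \<bullet> x}" "F = P \<inter> {x. emb (facet_normal P F) \<bullet> x = c}"
    using facet_normal_is_primitive_normal[OF assms] unfolding is_primitive_normal_def by blast
  obtain p where p: "p \<in> F" using assms(3) by (auto simp: facets_def facet_of_def)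
  have p': "p \<in> P" "emb (facet_normal P F) \<bullet> p = c" using p c(2) by auto
  show ?thesis
  proof (intro iffI conjI ballI)
    assume "x \<in> P \<and> (\<forall>y\<in>P. emb (facet_normal P F) \<bullet> x \<le> emb (facet_normal P F) \<bullet> y)"
    then have "x \<in> P" "emb (facet_normal P F) \<bullet> x \<le> c" using p' by auto
    then show "x \<in> F" using c by force
  next
    fix y assume "x \<in> F" "y \<in> P"
    then show "emb (facet_normal P F) \<bullet> x \<le> emb (facet_normal P F) \<bullet> y" using c by auto
  next
    assume "x \<in> F"
    then show "x \<in> P" using c(2) by blast
  qed
qed

text \<open>If z were outside, the segment to it from an interior point y would leave
  \<open>P\<close> at a point x of some facet. The normal of that facet is smaller at x than at y,
  so it is smaller still at z, against \<open>ineq\<close>.\<close>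

lemma full_dim_polytope_facet_inequalities:
  fixes P :: "(real ^ 'n) set"
  assumes "lattice_polytope P" "aff_dim P = int CARD('n)"
    and ineq: "\<And>F p. F \<in> facets P \<Longrightarrow> p \<in> F \<Longrightarrow> emb (facet_normal P F) \<bullet> p \<le> emb (facet_normal P F) \<bullet> z"
  shows "z \<in> P"
proof (rule ccontr)
  assume z: "z \<notin> P"
  have poly: "polytope P" using polytope_lattice_polytope assms(1) by blast
  have int: "rel_interior P = interior P" "interior P \<noteq> {}"
  proof -
    show "rel_interior P = interior P" using assms(2) by (simp add: interior_rel_interior_gen)
    moreover have "P \<noteq> {}" using assms(2) by auto
    ultimately show "interior P \<noteq> {}"
      using rel_interior_eq_empty polytope_imp_convex[OF poly] by metis
  qed
  then obtain y where y: "y \<in> interior P" by blast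
  have "closed_segment y z \<inter> P \<noteq> {}" "closed_segment y z - P \<noteq> {}"
    using y z interior_subset by fastforce+
  then obtain x where x: "x \<in> closed_segment y z" "x \<in> frontier P"
    using connected_Int_frontier[of "closed_segment y z" P] by blast
  then have "x \<in> P - rel_interior P"
    using polytope_imp_closed[OF poly] int by (simp add: frontier_def)
  then obtain F where F: "F \<in> facets P" "x \<in> F"
    using rel_boundary_of_polyhedron[OF polytope_imp_polyhedron[OF poly]] by (auto simp: facets_def)
  define u where "u = emb (facet_normal P F)"
  obtain t where t: "0 \<le> t" "t \<le> 1" "x = (1 - t) *\<^sub>R y + t *\<^sub>R z"
    using x(1) by (auto simp: in_segment)
  have "t \<noteq> 1" using z t F facet_mem_iff[OF assms(1,2) F(1)] by auto
  have yP: "y \<in> P" using y interior_subset by blast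
  have "y \<notin> F"
    using face_of_disjoint_interior[of F P] F(1) y by (force simp: facets_def facet_of_def)
  then have "u \<bullet> x < u \<bullet> y"
    using facet_mem_iff[OF assms(1,2) F(1)] F(2) yP unfolding u_def by (meson linorder_not_less order.trans)
  moreover have "u \<bullet> x \<le> u \<bullet> z" using ineq F unfolding u_def by blast
  moreover have "u \<bullet> x = (1 - t) * (u \<bullet> y) + t * (u \<bullet> z)" using t(3) by (simp add: inner_add_right)
  ultimately have "(1 - t) * (u \<bullet> y - u \<bullet> x) + t * (u \<bullet> z - u \<bullet> x) = 0"
    by (simp add: algebra_simps)
  moreover have "(1 - t) * (u \<bullet> y - u \<bullet> x) > 0"
    using \<open>t \<noteq> 1\<close> t(2) \<open>u \<bullet> x < u \<bullet> y\<close> by simp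
  moreover have "t * (u \<bullet> z - u \<bullet> x) \<ge> 0" using t(1) \<open>u \<bullet> x \<le> u \<bullet> z\<close> by simp
  ultimately show False by linarith
qed

section \<open>Polytopes with the same normal fan\<close>

lemma polytope_minimizing_vertex:
  fixes P :: "'a :: euclidean_space set"
  assumes "polytope P" "P \<noteq> {}"
  shows "\<exists>v. v extreme_point_of P \<and> (\<forall>x\<in>P. w \<bullet> v \<le> w \<bullet> x)"
proof -
  have "continuous_on P (\<lambda>x. w \<bullet> x)" by (intro continuous_intros)
  then obtain x0 where x0: "x0 \<in> P" "\<forall>x\<in>P. w \<bullet> x0 \<le> w \<bullet> x"
    using continuous_attains_inf[OF polytope_imp_compact[OF assms(1)] assms(2)] by blast
  have "P \<inter> {x. w \<bullet> x = w \<bullet> x0} face_of P"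
    using x0 by (intro face_of_Int_supporting_hyperplane_ge polytope_imp_convex assms) auto
  then obtain v where "v extreme_point_of (P \<inter> {x. w \<bullet> x = w \<bullet> x0})" "v extreme_point_of P"
    using face_has_extreme_point[OF assms(1)] x0(1) by blast
  moreover from this have "w \<bullet> v = w \<bullet> x0" by (auto simp: extreme_point_of_def)
  ultimately show ?thesis using x0(2) by auto
qed

text \<open>The exponent of X_F in the monomial of \<open>m\<close>, that is, its order of vanishing
  along the divisor of \<open>F\<close>. As an integer it can be shifted and subtracted without
  truncation.\<close>

definition divisor_order :: "(real ^ 'n) set \<Rightarrow> (real ^ 'n) set \<Rightarrow> int ^ 'n \<Rightarrow> (real ^ 'n) set \<Rightarrow> int" where
  "divisor_order P P' m F = pairing m (facet_normal P F) + support_numbers P P' F"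

text \<open>For a lattice point of \<open>P'\<close> this set encodes the face of \<open>P'\<close>
  with \<open>m\<close> in its relative interior, labelled by facets of \<open>P\<close>.\<close>

definition tight_facets :: "(real ^ 'n) set \<Rightarrow> (real ^ 'n) set \<Rightarrow> int ^ 'n \<Rightarrow> (real ^ 'n) set set" where
  "tight_facets P P' m = {F \<in> facets P. divisor_order P P' m F = 0}"

text \<open>Instantiated both with \<open>P' = P\<close> and with the larger polytope. The condition
  on \<open>p\<close> makes coprimality exclude a zero determinant, since 0 is coprime to 1 but to
  no other natural number.\<close>

locale polytope_pair =
  fixes P P' :: "(real ^ 'n) set" and p :: nat
  assumes standing: "standing_assumptions P p" and p_neq_1: "p \<noteq> 1"
    and lattice': "lattice_polytope P'" and same_fan: "normal_fan P' = normal_fan P"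
begin

lemma lattice: "lattice_polytope P"
  and full_dim: "aff_dim P = int CARD('n)"
  and polytope: "polytope P" and polytope': "polytope P'"
  using standing polytope_lattice_polytope lattice' by (auto simp: standing_assumptions_def)

lemma nonempty: "P \<noteq> {}"
  using full_dim by auto

lemma finite_facets: "finite (facets P)"
  unfolding facets_def using finite_polytope_facets polytope by blast

lemma vertex_matrix:
  assumes "v extreme_point_of P"
  obtains b :: "'n \<Rightarrow> (real ^ 'n) set" where "bij_betw b UNIV {F \<in> facets P. v \<in> F}"
    and "det (\<chi> i. facet_normal P (b i)) \<noteq> 0"
proof -
  have "finite {F \<in> facets P. v \<in> F}" using finite_facets by simp
  moreover have "card {F \<in> facets P. v \<in> F} = CARD('n)"
    using standing assms by (auto simp: standing_assumptions_def simple_polytope_def)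
  ultimately obtain b :: "'n \<Rightarrow> (real ^ 'n) set" where b: "bij_betw b UNIV {F \<in> facets P. v \<in> F}"
    by (metis finite_class.finite_UNIV finite_same_card_bij)
  have "coprime (det (\<chi> i. facet_normal P (b i))) (int p)"
    using standing assms b by (auto simp: standing_assumptions_def vertex_dets_coprime_def)
  then have "det (\<chi> i. facet_normal P (b i)) \<noteq> 0" using p_neq_1 by auto
  then show ?thesis using b that by blast
qed

text \<open>The N normals at a vertex of a simple polytope form a basis, so the point is the sign of
  the coefficients. The lemma extends estimates for the facet normals at \<open>v\<close> to every
  functional minimized at \<open>v\<close>.\<close>

lemma normal_cone_vertex_generated:
  assumes v: "v extreme_point_of P" and w: "w \<in> normal_cone P {v}"
  obtains a where "\<And>F. F \<in> facets P \<Longrightarrow> v \<in> F \<Longrightarrow> a F \<ge> (0::real)"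
    and "w = (\<Sum>F | F \<in> facets P \<and> v \<in> F. a F *\<^sub>R emb (facet_normal P F))"
proof -
  obtain b :: "'n \<Rightarrow> (real ^ 'n) set" where b: "bij_betw b UNIV {F \<in> facets P. v \<in> F}"
    and det: "det (\<chi> i. facet_normal P (b i)) \<noteq> 0"
    using vertex_matrix[OF v] by blast
  define A where "A = (\<chi> i. facet_normal P (b i))"
  obtain B d where Bd: "d > 0" "B ** A = mat d" "A ** B = mat d"
    using nonsingular_int_matrix_scaled_inverse det unfolding A_def by blast
  define e where "e i = (\<chi> j. B $ j $ i)" for i
  define a where "a F = (w \<bullet> emb (e (inv_into UNIV b F))) / of_int d" for F
  have inv_b: "inv_into UNIV b (b i) = i" for i
    using b by (simp add: bij_betw_def inv_into_f_f)
  have vP: "v \<in> P" using v by (simp add: extreme_point_of_def)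
  have Ae: "pairing (e i) (facet_normal P (b k)) = (if k = i then d else 0)" for i k
  proof -
    have "pairing (e i) (facet_normal P (b k)) = (A ** B) $ k $ i"
      by (simp add: pairing_def e_def A_def matrix_matrix_mult_def mult.commute)
    then show ?thesis by (simp add: Bd mat_def)
  qed
  text \<open>The \<open>e i\<close> are, up to the factor \<open>d\<close>, dual to the normals at \<open>v\<close>, so a short step along
    \<open>e i\<close> stays in \<open>P\<close>; hence the coefficients of \<open>w\<close> are nonnegative.\<close>
  have nonneg: "w \<bullet> emb (e i) \<ge> 0" for i
  proof -
    have ev: "eventually (\<lambda>t. \<forall>p\<in>F. emb (facet_normal P F) \<bullet> p \<le> emb (facet_normal P F) \<bullet> (v + t *\<^sub>R emb (e i)))
      (at_right 0)" if F: "F \<in> facets P" for F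
    proof -
      define n where "n = emb (facet_normal P F)"
      obtain q where q: "q \<in> F" using F by (auto simp: facets_def facet_of_def)
      have n: "n \<bullet> p \<le> n \<bullet> y" if "p \<in> F" "y \<in> P" for p y
        using facet_mem_iff[OF lattice full_dim F] that unfolding n_def by blast
      have qP: "q \<in> P" and nq: "\<And>p. p \<in> F \<Longrightarrow> n \<bullet> p \<le> n \<bullet> q"
        using facet_mem_iff[OF lattice full_dim F] q unfolding n_def by blast+
      show ?thesis
      proof (cases "v \<in> F")
        case True
        then obtain k where "F = b k" using F b by (auto simp: bij_betw_def)
        then have "n \<bullet> emb (e i) \<ge> 0"
          using Ae[of i k] Bd(1) by (simp add: n_def emb_inner_emb)
        then have "n \<bullet> p \<le> n \<bullet> (v + t *\<^sub>R emb (e i))" if "t > 0" "p \<in> F" for t p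
          using n[OF that(2) vP] that(1) by (simp add: inner_add_right add_increasing2)
        then show ?thesis unfolding n_def[symmetric] eventually_at_right_field
          by (intro exI[of _ 1]) auto
      next
        case False
        \<comment> \<open>A facet not through \<open>v\<close> has slack at \<open>v\<close>, and by
          continuity the slack survives a short step.\<close>
        have "n \<bullet> q < n \<bullet> v"
        proof (rule ccontr)
          assume "\<not> ?thesis"
          then have "\<forall>y\<in>P. n \<bullet> v \<le> n \<bullet> y" using n[OF q] by fastforce
          then show False using False vP facet_mem_iff[OF lattice full_dim F] unfolding n_def by blast
        qed
        moreover have "((\<lambda>t. n \<bullet> (v + t *\<^sub>R emb (e i))) \<longlongrightarrow> n \<bullet> (v + 0 *\<^sub>R emb (e i))) (at_right 0)"
          by (intro tendsto_intros)
        ultimately have "eventually (\<lambda>t. n \<bullet> q < n \<bullet> (v + t *\<^sub>R emb (e i))) (at_right 0)"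
          using order_tendstoD(1) by fastforce
        then show ?thesis unfolding n_def[symmetric]
          by (rule eventually_mono) (use nq in force)
      qed
    qed
    have "eventually (\<lambda>t. \<forall>F\<in>facets P. \<forall>p\<in>F.
        emb (facet_normal P F) \<bullet> p \<le> emb (facet_normal P F) \<bullet> (v + t *\<^sub>R emb (e i))) (at_right 0)"
      using ev by (intro eventually_ball_finite finite_facets) blast
    then obtain t :: real where t: "t > 0" "\<forall>F\<in>facets P. \<forall>p\<in>F.
        emb (facet_normal P F) \<bullet> p \<le> emb (facet_normal P F) \<bullet> (v + t *\<^sub>R emb (e i))"
      unfolding eventually_at_right_field by (metis dense)
    then have "v + t *\<^sub>R emb (e i) \<in> P"
      using full_dim_polytope_facet_inequalities[OF lattice full_dim] by blast
    then have "w \<bullet> v \<le> w \<bullet> (v + t *\<^sub>R emb (e i))" using w by (auto simp: normal_cone_def)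
    then show ?thesis using t(1) by (simp add: inner_add_right zero_le_mult_iff)
  qed
  have "w $ k = (\<Sum>F | F \<in> facets P \<and> v \<in> F. a F *\<^sub>R emb (facet_normal P F)) $ k" for k
  proof -
    \<comment> \<open>The coefficients form the row vector w B / d; multiplying by A gives back w
      because B A = d.\<close>
    have "(\<Sum>F | F \<in> facets P \<and> v \<in> F. a F *\<^sub>R emb (facet_normal P F)) $ k
        = (\<Sum>i\<in>UNIV. a (b i) * real_of_int (A $ i $ k))"
      using sum.reindex_bij_betw[OF b, of "\<lambda>F. a F * real_of_int (facet_normal P F $ k)"]
      by (simp add: A_def emb_def)
    also have "\<dots> = (\<Sum>i\<in>UNIV. \<Sum>j\<in>UNIV. w $ j * real_of_int (B $ j $ i) / of_int d * real_of_int (A $ i $ k))"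
      by (simp add: a_def inv_b inner_vec_def emb_def e_def sum_distrib_right sum_divide_distrib)
    also have "\<dots> = (\<Sum>j\<in>UNIV. w $ j / of_int d * real_of_int ((B ** A) $ j $ k))"
      by (subst sum.swap) (simp add: matrix_matrix_mult_def sum_distrib_left mult_ac)
    also have "\<dots> = w $ k"
      using Bd(1) by (simp add: Bd(2) mat_def if_distrib[of real_of_int] if_distrib[of "\<lambda>x. _ * x"] sum.delta cong: if_cong)
    finally show ?thesis by simp
  qed
  then have "w = (\<Sum>F | F \<in> facets P \<and> v \<in> F. a F *\<^sub>R emb (facet_normal P F))"
    by (simp add: vec_eq_iff)
  moreover have "a F \<ge> 0" for F using nonneg Bd(1) by (simp add: a_def)
  ultimately show ?thesis by (intro that[of a])
qed

section \<open>Transfer along the common normal fan\<close>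

lemma facet_normal_in_normal_cone:
  assumes "F \<in> facets P" "v \<in> F"
  shows "emb (facet_normal P F) \<in> normal_cone P {v}"
  using facet_mem_iff[OF lattice full_dim assms(1)] assms(2) by (auto simp: normal_cone_def)

text \<open>The cone of \<open>v\<close> occurs in the fan of \<open>P'\<close> as the cone of some
  face. Passing to a vertex of that face can only enlarge the cone, and it yields a lattice
  point.\<close>

lemma vertex_correspondence:
  assumes "v extreme_point_of P"
  obtains m where "emb m \<in> P'" "normal_cone P {v} \<subseteq> normal_cone P' {emb m}"
proof -
  have "normal_cone P {v} \<in> normal_fan P'"
    unfolding same_fan unfolding normal_fan_def using assms face_of_singleton[of v P] by blast
  then obtain Q where Q: "Q face_of P'" "Q \<noteq> {}" "normal_cone P {v} = normal_cone P' Q"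
    by (auto simp: normal_fan_def)
  obtain x where x: "x extreme_point_of Q" "x extreme_point_of P'"
    using face_has_extreme_point[OF polytope' Q(1,2)] by blast
  then obtain m where m: "x = emb m" using extreme_point_lattice_polytope[OF lattice'] by blast
  have "x \<in> Q" "x \<in> P'" using x by (auto simp: extreme_point_of_def)
  then show ?thesis using that[of m] Q(3) m by (auto simp: normal_cone_def)
qed

text \<open>Read from \<open>P'\<close> to \<open>P\<close>, the transfer again enlarges the cone.
  It will gather all facets tight on one face of \<open>P'\<close> at a single vertex of
  \<open>P\<close>.\<close>

lemma face_correspondence:
  assumes "Q face_of P'" "Q \<noteq> {}"
  obtains v where "v extreme_point_of P" "normal_cone P' Q \<subseteq> normal_cone P {v}"
proof -
  have "normal_cone P' Q \<in> normal_fan P"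
    unfolding same_fan[symmetric] using assms by (auto simp: normal_fan_def)
  then obtain Q' where Q': "Q' face_of P" "Q' \<noteq> {}" "normal_cone P' Q = normal_cone P Q'"
    by (auto simp: normal_fan_def)
  obtain x where x: "x extreme_point_of Q'" "x extreme_point_of P"
    using face_has_extreme_point[OF polytope Q'(1,2)] by blast
  then show ?thesis using that[of x] Q'(3) by (auto simp: normal_cone_def extreme_point_of_def)
qed

text \<open>This justifies the \<open>THE\<close> in \<open>support_numbers\<close>. Each facet
  normal attains its minimum over \<open>P'\<close> at a lattice vertex, so the minimum is an
  integer. That these inequalities define \<open>P'\<close> comes from the fan: a functional
  separating a point from \<open>P'\<close> is a nonnegative combination of the normals at one
  vertex of \<open>P\<close>, and all these normals are minimized over \<open>P'\<close> at one
  common point.\<close>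

lemma support_numbers_ex1:
  "\<exists>!\<alpha>. \<alpha> \<in> facets P \<rightarrow>\<^sub>E (UNIV :: int set) \<and>
     P' = {m. \<forall>F\<in>facets P. emb (facet_normal P F) \<bullet> m \<ge> - real_of_int (\<alpha> F)} \<and>
     (\<forall>F\<in>facets P. \<exists>m\<in>P'. emb (facet_normal P F) \<bullet> m = - real_of_int (\<alpha> F))"
    (is "\<exists>!\<alpha>. ?S \<alpha>")
proof (rule ex_ex1I)
  have ne: "P' \<noteq> {}"
    using vertex_correspondence polytope_minimizing_vertex[OF polytope nonempty] by blast
  have "\<exists>z. (\<forall>x\<in>P'. emb (facet_normal P F) \<bullet> x \<ge> - real_of_int z) \<and>
      (\<exists>x\<in>P'. emb (facet_normal P F) \<bullet> x = - real_of_int z)" for F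
  proof -
    obtain v where v: "v extreme_point_of P'"
      "\<forall>x\<in>P'. emb (facet_normal P F) \<bullet> v \<le> emb (facet_normal P F) \<bullet> x"
      using polytope_minimizing_vertex[OF polytope' ne] by blast
    obtain m where m: "v = emb m" using extreme_point_lattice_polytope[OF lattice' v(1)] by blast
    have "v \<in> P'" using v by (simp add: extreme_point_of_def)
    then show ?thesis using v(2) unfolding m
      by (intro exI[of _ "- pairing m (facet_normal P F)"] conjI bexI[of _ "emb m"]) (auto simp: emb_inner_emb)
  qed
  then obtain z where z: "\<And>F. (\<forall>x\<in>P'. emb (facet_normal P F) \<bullet> x \<ge> - real_of_int (z F)) \<and>
      (\<exists>x\<in>P'. emb (facet_normal P F) \<bullet> x = - real_of_int (z F))"
    by metis
  define \<alpha> where "\<alpha> = restrict z (facets P)"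
  have "x \<in> P'" if x: "\<forall>F\<in>facets P. emb (facet_normal P F) \<bullet> x \<ge> - real_of_int (\<alpha> F)" for x
  proof (rule ccontr)
    assume "x \<notin> P'"
    then obtain w c where w: "w \<bullet> x < c" "\<forall>y\<in>P'. c < w \<bullet> y"
      using separating_hyperplane_closed_point[of P' x] polytope_imp_convex[OF polytope']
        polytope_imp_closed[OF polytope'] by blast
    obtain v where v: "v extreme_point_of P" "\<forall>y\<in>P. w \<bullet> v \<le> w \<bullet> y"
      using polytope_minimizing_vertex[OF polytope nonempty] by blast
    then have wv: "w \<in> normal_cone P {v}" by (auto simp: normal_cone_def)
    obtain m where m: "emb m \<in> P'" "normal_cone P {v} \<subseteq> normal_cone P' {emb m}"
      using vertex_correspondence[OF v(1)] .
    obtain a where a: "\<And>F. F \<in> facets P \<Longrightarrow> v \<in> F \<Longrightarrow> a F \<ge> (0::real)"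
      "w = (\<Sum>F | F \<in> facets P \<and> v \<in> F. a F *\<^sub>R emb (facet_normal P F))"
      using normal_cone_vertex_generated[OF v(1) wv] by blast
    have "w \<bullet> emb m \<le> w \<bullet> x"
      unfolding a(2) inner_sum_left inner_scaleR_left
    proof (intro sum_mono mult_left_mono)
      fix F assume F: "F \<in> {F \<in> facets P. v \<in> F}"
      then have "emb (facet_normal P F) \<in> normal_cone P' {emb m}"
        using facet_normal_in_normal_cone m(2) by blast
      moreover obtain y where "y \<in> P'" "emb (facet_normal P F) \<bullet> y = - real_of_int (z F)"
        using z by blast
      ultimately have "emb (facet_normal P F) \<bullet> emb m \<le> - real_of_int (z F)"
        by (auto simp: normal_cone_def)
      then show "emb (facet_normal P F) \<bullet> emb m \<le> emb (facet_normal P F) \<bullet> x"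
        using x F by (force simp: \<alpha>_def)
      show "0 \<le> a F" using a(1) F by blast
    qed
    then show False using w m(1) by fastforce
  qed
  then have "?S \<alpha>" using z by (auto simp: \<alpha>_def)
  then show "\<exists>\<alpha>. ?S \<alpha>" by (intro exI[of _ \<alpha>])
next
  fix \<alpha> \<beta> assume A: "?S \<alpha>" and B: "?S \<beta>"
  have le: "\<alpha> F \<le> \<beta> F" if F: "F \<in> facets P" and A: "?S \<alpha>" and B: "?S \<beta>" for F \<alpha> \<beta>
  proof -
    obtain y where "y \<in> P'" "emb (facet_normal P F) \<bullet> y = - real_of_int (\<alpha> F)"
      using A F by meson
    moreover have "\<And>y. y \<in> P' \<Longrightarrow> emb (facet_normal P F) \<bullet> y \<ge> - real_of_int (\<beta> F)"
      using B F by blast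
    ultimately have "- real_of_int (\<alpha> F) \<ge> - real_of_int (\<beta> F)" by metis
    then show ?thesis by linarith
  qed
  have "\<alpha> F = \<beta> F" if "F \<in> facets P" for F
    using le[OF that A B] le[OF that B A] by simp
  then show "\<alpha> = \<beta>"
    by (intro PiE_ext[of \<alpha> "facets P" "\<lambda>_. UNIV" \<beta>]) (use A B in auto)
qed

lemma polytope_eq_support_numbers:
  "P' = {m. \<forall>F\<in>facets P. emb (facet_normal P F) \<bullet> m \<ge> - real_of_int (support_numbers P P' F)}"
  and support_numbers_tight:
  "F \<in> facets P \<Longrightarrow> \<exists>m\<in>P'. emb (facet_normal P F) \<bullet> m = - real_of_int (support_numbers P P' F)"
  using theI'[OF support_numbers_ex1] unfolding support_numbers_def[symmetric] by blast+

lemma lattice_points_iff_divisor_order_nonneg: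
  "m \<in> lattice_points P' \<longleftrightarrow> (\<forall>F\<in>facets P. divisor_order P P' m F \<ge> 0)"
proof -
  have "m \<in> lattice_points P' \<longleftrightarrow>
    (\<forall>F\<in>facets P. emb (facet_normal P F) \<bullet> emb m \<ge> - real_of_int (support_numbers P P' F))"
    unfolding lattice_points_def by (subst polytope_eq_support_numbers) simp
  also have "\<dots> \<longleftrightarrow> (\<forall>F\<in>facets P. divisor_order P P' m F \<ge> 0)"
    unfolding emb_inner_emb divisor_order_def
    by (intro ball_cong refl) linarith
  finally show ?thesis .
qed

lemma tight_facets_iff:
  "F \<in> tight_facets P P' m \<longleftrightarrow>
    F \<in> facets P \<and> emb (facet_normal P F) \<bullet> emb m = - real_of_int (support_numbers P P' F)"
  unfolding tight_facets_def divisor_order_def emb_inner_emb by auto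

text \<open>The point of \<open>P'\<close> matching \<open>v\<close> acts as a local origin: on
  facets through \<open>v\<close>, the \<open>divisor_order\<close> of any lattice point equals the
  pairing with its difference from this one.\<close>

lemma vertex_lattice_point:
  assumes "v extreme_point_of P"
  obtains m where "\<And>F. F \<in> facets P \<Longrightarrow> v \<in> F \<Longrightarrow> divisor_order P P' m F = 0"
proof -
  obtain m where m: "emb m \<in> P'" "normal_cone P {v} \<subseteq> normal_cone P' {emb m}"
    using vertex_correspondence[OF assms] .
  have "divisor_order P P' m F = 0" if F: "F \<in> facets P" "v \<in> F" for F
  proof -
    have "emb (facet_normal P F) \<in> normal_cone P' {emb m}"
      using facet_normal_in_normal_cone[OF F] m(2) by blast
    moreover obtain y where "y \<in> P'" "emb (facet_normal P F) \<bullet> y = - real_of_int (support_numbers P P' F)"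
      using support_numbers_tight[OF F(1)] by blast
    ultimately have "emb (facet_normal P F) \<bullet> emb m \<le> - real_of_int (support_numbers P P' F)"
      by (auto simp: normal_cone_def)
    then have "divisor_order P P' m F \<le> 0" by (simp add: emb_inner_emb divisor_order_def)
    moreover have "divisor_order P P' m F \<ge> 0"
      using lattice_points_iff_divisor_order_nonneg[of m] m(1) F(1) by (auto simp: lattice_points_def)
    ultimately show ?thesis by simp
  qed
  then show ?thesis using that by blast
qed

section \<open>The face whose relative interior contains a given lattice point\<close>

definition carrier_face :: "int ^ 'n \<Rightarrow> (real ^ 'n) set" where
  "carrier_face m = {x \<in> P'. \<forall>F\<in>tight_facets P P' m.
     emb (facet_normal P F) \<bullet> x = - real_of_int (support_numbers P P' F)}"

lemma inequalities: "x \<in> P' \<Longrightarrow> F \<in> facets P \<Longrightarrow>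
    - real_of_int (support_numbers P P' F) \<le> emb (facet_normal P F) \<bullet> x"
  using polytope_eq_support_numbers by blast

lemma carrier_face_face_of: "carrier_face m face_of P'"
proof -
  have conv: "convex P'" using polytope_imp_convex[OF polytope'] .
  have "carrier_face m = \<Inter> (insert P' ((\<lambda>F. P' \<inter> {x. emb (facet_normal P F) \<bullet> x =
      - real_of_int (support_numbers P P' F)}) ` tight_facets P P' m))"
    by (auto simp: carrier_face_def)
  also have "\<dots> face_of P'"
    using face_of_refl[OF conv] inequalities
    by (intro face_of_Inter) (auto simp: tight_facets_def intro!: face_of_Int_supporting_hyperplane_ge[OF conv])
  finally show ?thesis .
qed

lemma mem_carrier_face: "m \<in> lattice_points P' \<Longrightarrow> emb m \<in> carrier_face m"
  by (auto simp: carrier_face_def tight_facets_iff lattice_points_def)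

text \<open>The normals of the tight facets lie in the cone of the carrier face, hence in the cone
  of one vertex of \<open>P\<close>. The common vertex is what keeps a point off the irrelevant
  locus when its coordinates at these facets are set to zero.\<close>

lemma tight_facets_at_vertex:
  assumes "m \<in> lattice_points P'"
  obtains v where "v extreme_point_of P" "\<And>F. F \<in> tight_facets P P' m \<Longrightarrow> v \<in> F"
proof -
  obtain v where v: "v extreme_point_of P" "normal_cone P' (carrier_face m) \<subseteq> normal_cone P {v}"
    using face_correspondence[OF carrier_face_face_of] mem_carrier_face[OF assms] by blast
  have "v \<in> F" if F: "F \<in> tight_facets P P' m" for F
  proof -
    have fac: "F \<in> facets P" using F by (simp add: tight_facets_def)
    have "emb (facet_normal P F) \<in> normal_cone P' (carrier_face m)"
      using F inequalities[OF _ fac] by (auto simp: normal_cone_def carrier_face_def)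
    then have "emb (facet_normal P F) \<in> normal_cone P {v}" using v(2) by blast
    then show ?thesis
      using v(1) facet_mem_iff[OF lattice full_dim fac] by (auto simp: normal_cone_def extreme_point_of_def)
  qed
  then show ?thesis using that v(1) by blast
qed

text \<open>A short step from \<open>m\<close> directly away from \<open>x\<close> keeps the tight
  equations and, by slack, the other inequalities. So \<open>m\<close> is inside a segment of the
  carrier face that ends in \<open>x\<close>, and a face containing \<open>m\<close> contains
  \<open>x\<close>.\<close>

lemma carrier_face_minimal:
  assumes m: "m \<in> lattice_points P'" and Q: "Q face_of carrier_face m" "emb m \<in> Q"
  shows "Q = carrier_face m"
proof
  show "Q \<subseteq> carrier_face m" using Q(1) by (rule face_of_imp_subset)
  show "carrier_face m \<subseteq> Q"
  proof
    fix x assume x: "x \<in> carrier_face m"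
    define y where "y t = emb m + t *\<^sub>R (emb m - x)" for t :: real
    have ev: "eventually (\<lambda>t. - real_of_int (support_numbers P P' F) \<le> emb (facet_normal P F) \<bullet> y t) (at_right 0)"
      if F: "F \<in> facets P" for F
    proof (cases "F \<in> tight_facets P P' m")
      case True
      then have "emb (facet_normal P F) \<bullet> emb m = emb (facet_normal P F) \<bullet> x"
        "emb (facet_normal P F) \<bullet> emb m = - real_of_int (support_numbers P P' F)"
        using x by (auto simp: carrier_face_def tight_facets_iff)
      then show ?thesis by (simp add: y_def inner_add_right inner_diff_right)
    next
      case False
      then have "- real_of_int (support_numbers P P' F) < emb (facet_normal P F) \<bullet> emb m"
        using inequalities[OF _ F, of "emb m"] m F by (force simp: tight_facets_iff lattice_points_def)
      moreover have "((\<lambda>t. emb (facet_normal P F) \<bullet> y t) \<longlongrightarrow> emb (facet_normal P F) \<bullet> y 0) (at_right 0)"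
        unfolding y_def by (intro tendsto_intros)
      ultimately have "eventually (\<lambda>t. - real_of_int (support_numbers P P' F) < emb (facet_normal P F) \<bullet> y t) (at_right 0)"
        by (intro order_tendstoD(1)[of _ "emb (facet_normal P F) \<bullet> y 0"]) (auto simp: y_def)
      then show ?thesis by (rule eventually_mono) simp
    qed
    have "eventually (\<lambda>t. \<forall>F\<in>facets P. - real_of_int (support_numbers P P' F) \<le> emb (facet_normal P F) \<bullet> y t) (at_right 0)"
      using ev by (intro eventually_ball_finite finite_facets) blast
    then obtain t :: real where t: "t > 0" "\<forall>F\<in>facets P. - real_of_int (support_numbers P P' F) \<le> emb (facet_normal P F) \<bullet> y t"
      unfolding eventually_at_right_field by (metis dense)
    have "y t \<in> P'" by (subst polytope_eq_support_numbers) (use t(2) in simp)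
    moreover have "emb (facet_normal P F) \<bullet> y t = - real_of_int (support_numbers P P' F)"
      if "F \<in> tight_facets P P' m" for F
    proof -
      have "emb (facet_normal P F) \<bullet> emb m = emb (facet_normal P F) \<bullet> x"
        "emb (facet_normal P F) \<bullet> emb m = - real_of_int (support_numbers P P' F)"
        using x that by (auto simp: carrier_face_def tight_facets_iff)
      then show ?thesis by (simp add: y_def inner_add_right inner_diff_right)
    qed
    ultimately have yt: "y t \<in> carrier_face m" by (auto simp: carrier_face_def)
    show "x \<in> Q"
    proof (cases "x = emb m")
      case True then show ?thesis using Q(2) by simp
    next
      case False
      \<comment> \<open>The weights come from solving y t = m + t (m - x) for m.\<close>
      have m_eq: "emb m = (1 - 1 / (1 + t)) *\<^sub>R x + (1 / (1 + t)) *\<^sub>R y t"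
      proof -
        have "(1 + t) *\<^sub>R emb m = t *\<^sub>R x + y t" by (simp add: y_def algebra_simps)
        then have "emb m = (1 / (1 + t)) *\<^sub>R (t *\<^sub>R x + y t)"
          using t(1) by (metis add_pos_pos divide_self_if less_numeral_extra(1,3) scaleR_one scaleR_scaleR times_divide_eq_left mult_1)
        moreover have "t / (1 + t) = 1 - 1 / (1 + t)" using t(1) by (simp add: field_simps)
        ultimately show ?thesis by (simp add: scaleR_add_right)
      qed
      have "x \<noteq> y t"
      proof
        assume "x = y t"
        then have "(1 + t) *\<^sub>R (x - emb m) = 0" by (simp add: y_def algebra_simps)
        then show False using False t(1) by simp
      qed
      then have "emb m \<in> open_segment x (y t)"
        unfolding in_segment using t(1) m_eq by (intro conjI exI[of _ "1 / (1 + t)"]) auto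
      then show ?thesis using face_ofD[OF Q(1) _ x yt Q(2)] by blast
    qed
  qed
qed

text \<open>The hyperplane of a facet tight at one interior point of Q cuts out a face of Q that
  meets the interior, hence all of Q. Conversely every lattice point is interior to its carrier
  face. Equivalence is thereby read off from exponents: the same variables occur, and the points
  agree modulo q - 1.\<close>

lemma red_equiv_iff:
  assumes m: "m \<in> lattice_points P'" and m': "m' \<in> lattice_points P'"
  shows "red_equiv q P' m m' \<longleftrightarrow>
    tight_facets P P' m = tight_facets P P' m' \<and> (\<forall>i. (int q - 1) dvd (m $ i - m' $ i))"
proof -
  have sub: "tight_facets P P' m1 \<subseteq> tight_facets P P' m2"
    if Q: "Q face_of P'" "emb m1 \<in> face_interior Q" "emb m2 \<in> face_interior Q" for Q m1 m2
  proof
    fix F assume F: "F \<in> tight_facets P P' m1"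
    define Q' where "Q' = Q \<inter> {x. emb (facet_normal P F) \<bullet> x = - real_of_int (support_numbers P P' F)}"
    have "Q' face_of Q" unfolding Q'_def
    proof (rule face_of_Int_supporting_hyperplane_ge)
      show "convex Q" using Q(1) face_of_imp_convex by blast
      show "\<And>x. x \<in> Q \<Longrightarrow> emb (facet_normal P F) \<bullet> x \<ge> - real_of_int (support_numbers P P' F)"
        using inequalities F face_of_imp_subset[OF Q(1)] by (auto simp: tight_facets_def)
    qed
    moreover have "emb m1 \<in> Q'" using Q(2) F by (auto simp: Q'_def face_interior_def tight_facets_iff)
    ultimately have "Q' = Q" using Q(2) unfolding face_interior_def by blast
    then have "emb m2 \<in> Q'" using Q(3) unfolding face_interior_def by blast
    then show "F \<in> tight_facets P P' m2" using F by (auto simp: Q'_def tight_facets_iff)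
  qed
  have interior: "emb m \<in> face_interior (carrier_face m)" if "m \<in> lattice_points P'" for m
    using mem_carrier_face[OF that] carrier_face_minimal[OF that] unfolding face_interior_def by blast
  have "(\<exists>Q. Q face_of P' \<and> Q \<noteq> {} \<and> emb m \<in> face_interior Q \<and> emb m' \<in> face_interior Q)
    \<longleftrightarrow> tight_facets P P' m = tight_facets P P' m'" (is "?L \<longleftrightarrow> ?R")
  proof
    assume ?L then show ?R using sub by (meson equalityI)
  next
    assume ?R
    then have "carrier_face m = carrier_face m'" by (simp add: carrier_face_def)
    then show ?L using interior[OF m] interior[OF m'] carrier_face_face_of[of m] mem_carrier_face[OF m]
      by (intro exI[of _ "carrier_face m"]) auto
  qed
  then show ?thesis unfolding red_equiv_def by simp
qed

lemma finite_lattice_points': "finite (lattice_points P')"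
  by (rule finite_lattice_points[OF polytope_imp_bounded[OF polytope']])

end

section \<open>Finite fields and linear algebra\<close>

lemma finite_field_power_card_minus_1:
  fixes a :: "'k :: {field, finite}"
  assumes "a \<noteq> 0"
  shows "a ^ (CARD('k) - 1) = 1"
proof -
  have "bij_betw ((*) a) (UNIV - {0}) (UNIV - {0})"
    using assms by (intro bij_betwI[of _ _ _ "\<lambda>x. x / a"]) auto
  then have "(\<Prod>x\<in>UNIV - {0}. a * x) = (\<Prod>x\<in>UNIV - {0 :: 'k}. x)"
    by (rule prod.reindex_bij_betw)
  then have "a ^ (CARD('k) - 1) * (\<Prod>x\<in>UNIV - {0 :: 'k}. x) = 1 * (\<Prod>x\<in>UNIV - {0 :: 'k}. x)"
    by (simp add: prod.distrib card_Diff_subset)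
  moreover have "(\<Prod>x\<in>UNIV - {0 :: 'k}. x) \<noteq> 0" by simp
  ultimately show ?thesis using mult_right_cancel by blast
qed

lemma card_field_ge_2: "CARD('k :: {field, finite}) \<ge> 2"
proof -
  have "card {0, 1 :: 'k} \<le> CARD('k)" by (intro card_mono) auto
  then show ?thesis by simp
qed

text \<open>X^q - X has at most q roots in the closure, and the q elements of F_q already are
  roots.\<close>

lemma frobenius_fixed_in_range_to_ac:
  fixes z :: "'k :: {field, finite} alg_closure"
  assumes "z ^ CARD('k) = z"
  shows "z \<in> range to_ac"
proof -
  define p :: "'k alg_closure poly" where "p = Polynomial.monom 1 CARD('k) - Polynomial.monom 1 1"
  have q: "CARD('k) \<ge> 2" by (rule card_field_ge_2)
  have deg: "Polynomial.degree p = CARD('k)"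
  proof (rule antisym)
    show "Polynomial.degree p \<le> CARD('k)" unfolding p_def using q by (intro degree_diff_le degree_monom_le order_trans[OF degree_monom_le]) auto
    have "Polynomial.coeff p CARD('k) = 1" using q by (auto simp: p_def)
    then show "Polynomial.degree p \<ge> CARD('k)" by (intro le_degree) simp
  qed
  then have "p \<noteq> 0" using q by auto
  then have "finite {x. poly p x = 0}" "card {x. poly p x = 0} \<le> CARD('k)"
    using poly_roots_finite card_poly_roots_bound[of p] deg by auto
  moreover have "range (to_ac :: 'k \<Rightarrow> _) \<subseteq> {x. poly p x = 0}"
  proof
    fix x :: "'k alg_closure" assume "x \<in> range to_ac"
    then obtain a where a: "x = to_ac a" by blast
    have "a ^ CARD('k) = a"
    proof (cases "a = 0")
      case False
      have "a ^ CARD('k) = a * a ^ (CARD('k) - 1)" using q by (simp flip: power_Suc)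
      then show ?thesis using finite_field_power_card_minus_1[OF False] by simp
    qed simp
    then show "x \<in> {x. poly p x = 0}"
      by (simp add: p_def poly_monom a flip: to_ac_power)
  qed
  moreover have "card (range (to_ac :: 'k \<Rightarrow> _)) = CARD('k)"
    by (simp add: card_image inj_to_ac)
  ultimately have "range (to_ac :: 'k \<Rightarrow> _) = {x. poly p x = 0}"
    by (intro card_seteq) auto
  then show ?thesis using assms by (simp add: p_def poly_monom)
qed

text \<open>If the remainder r of d modulo q - 1 were nonzero, all q - 1 nonzero elements would be
  roots of X^r - 1, more than its degree allows.\<close>

lemma finite_field_exponent:
  assumes "\<And>a :: 'k :: {field, finite}. a \<noteq> 0 \<Longrightarrow> a powi d = 1"
  shows "(int CARD('k) - 1) dvd d"
proof (rule ccontr)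
  assume ndvd: "\<not> ?thesis"
  have q: "CARD('k) \<ge> 2" by (rule card_field_ge_2)
  define n where "n = int CARD('k) - 1"
  define r where "r = nat (d mod n)"
  have n: "n > 0" using q by (simp add: n_def)
  have r: "int r = d mod n" using n by (simp add: r_def)
  have "r \<noteq> 0" using ndvd r by (auto simp: n_def dvd_eq_mod_eq_0)
  have "r < CARD('k) - 1" using pos_mod_bound[OF n, of d] r q unfolding n_def by linarith
  have root: "a ^ r = 1" if "a \<noteq> 0" for a :: 'k
  proof -
    have "a powi n = 1"
      using finite_field_power_card_minus_1[OF that] q
      by (simp add: n_def of_nat_diff flip: power_int_of_nat)
    then have "a powi (n * (d div n)) = 1" by (simp add: power_int_mult)
    moreover have "a powi d = a powi (n * (d div n)) * a powi int r"
      using that by (simp add: r flip: power_int_add)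
    ultimately show ?thesis using assms[OF that] by simp
  qed
  define p :: "'k poly" where "p = Polynomial.monom 1 r - 1"
  have deg: "Polynomial.degree p \<le> r" unfolding p_def
    by (intro degree_diff_le degree_monom_le) auto
  have "Polynomial.coeff p r = 1" using \<open>r \<noteq> 0\<close> by (simp add: p_def)
  then have "p \<noteq> 0" by auto
  then have "card {x. poly p x = 0} \<le> r" using card_poly_roots_bound[of p] deg by linarith
  moreover have "UNIV - {0} \<subseteq> {x. poly p x = 0}" using root by (auto simp: p_def poly_monom)
  then have "card (UNIV - {0 :: 'k}) \<le> card {x. poly p x = 0}" by (intro card_mono) auto
  ultimately show False using \<open>r < CARD('k) - 1\<close> by (simp add: card_Diff_subset)
qed

text \<open>The argument of Dedekind and Artin: multiplying the arguments of the relation by z and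
  subtracting \<open>\<phi> a z\<close> times the original relation removes the term of
  \<open>a\<close>. The remaining coefficients are scaled by \<open>\<phi> k z - \<phi> a z\<close>,
  and z is chosen to make this nonzero for the \<open>k\<close> in question.\<close>

lemma characters_linearly_independent:
  fixes \<phi> :: "'i \<Rightarrow> 'g \<Rightarrow> 'f :: field"
  assumes "finite A"
    and mult: "\<And>k y z. k \<in> A \<Longrightarrow> y \<in> Y \<Longrightarrow> z \<in> Y \<Longrightarrow> \<phi> k (mul y z) = \<phi> k y * \<phi> k z"
    and closed: "\<And>y z. y \<in> Y \<Longrightarrow> z \<in> Y \<Longrightarrow> mul y z \<in> Y"
    and one: "e \<in> Y" "\<And>k. k \<in> A \<Longrightarrow> \<phi> k e \<noteq> 0"
    and distinct: "\<And>k k'. k \<in> A \<Longrightarrow> k' \<in> A \<Longrightarrow> k \<noteq> k' \<Longrightarrow> \<exists>y\<in>Y. \<phi> k y \<noteq> \<phi> k' y"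
    and zero: "\<And>y. y \<in> Y \<Longrightarrow> (\<Sum>k\<in>A. c k * \<phi> k y) = 0"
    and "k \<in> A"
  shows "c k = 0"
  using assms(1,2,5-)
proof (induction A arbitrary: c k rule: finite_induct)
  case empty
  then show ?case by simp
next
  case (insert a A)
  have cA: "c k = 0" if k: "k \<in> A" for k
  proof -
    obtain z where z: "z \<in> Y" "\<phi> k z \<noteq> \<phi> a z"
      using insert.prems(3)[of k a] k insert.hyps(2) by blast
    have "c k * (\<phi> k z - \<phi> a z) = 0"
    proof (rule insert.IH[of "\<lambda>k. c k * (\<phi> k z - \<phi> a z)" k])
      fix y assume y: "y \<in> Y"
      have "(\<Sum>k\<in>insert a A. c k * \<phi> k (mul y z)) - \<phi> a z * (\<Sum>k\<in>insert a A. c k * \<phi> k y) = 0"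
        using insert.prems(4) closed y z(1) by simp
      also have "(\<Sum>k\<in>insert a A. c k * \<phi> k (mul y z)) = (\<Sum>k\<in>insert a A. c k * (\<phi> k y * \<phi> k z))"
        using insert.prems(1) y z(1) by (intro sum.cong) auto
      finally have "(\<Sum>k\<in>insert a A. c k * (\<phi> k z - \<phi> a z) * \<phi> k y) = 0"
        by (simp add: sum_distrib_left algebra_simps flip: sum_subtractf)
      then show "(\<Sum>k\<in>A. c k * (\<phi> k z - \<phi> a z) * \<phi> k y) = 0"
        using insert.hyps by simp
    qed (use insert.prems k in auto)
    then show ?thesis using z(2) by simp
  qed
  have "c a * \<phi> a e = 0" using insert.prems(4)[OF one(1)] insert.hyps cA by simp
  then have "c a = 0" using insert.prems(2)[of a] by simp
  then show ?case using cA insert.prems(5) by blast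
qed

lemma monomials_linearly_independent:
  fixes A :: "(int ^ 'n) set" and c :: "int ^ 'n \<Rightarrow> 'k :: {field, finite} alg_closure"
  assumes fin: "finite A"
    and incong: "\<And>k k'. k \<in> A \<Longrightarrow> k' \<in> A \<Longrightarrow> \<forall>i. (int CARD('k) - 1) dvd (k $ i - k' $ i) \<Longrightarrow> k = k'"
    and zero: "\<And>y :: 'n \<Rightarrow> 'k. (\<And>j. y j \<noteq> 0) \<Longrightarrow> (\<Sum>k\<in>A. c k * (\<Prod>j\<in>UNIV. to_ac (y j) powi (k $ j))) = 0"
    and k: "k \<in> A"
  shows "c k = 0"
proof (rule characters_linearly_independent[where \<phi> = "\<lambda>k y. \<Prod>j\<in>UNIV. to_ac (y j) powi (k $ j)"
      and Y = "{y. \<forall>j. y j \<noteq> 0}" and mul = "\<lambda>y z j. y j * z j" and e = "\<lambda>_. 1", OF fin])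
  show "\<exists>y\<in>{y. \<forall>j. y j \<noteq> 0}. (\<Prod>j\<in>UNIV. to_ac (y j) powi (k $ j)) \<noteq> (\<Prod>j\<in>UNIV. to_ac (y j :: 'k) powi (k' $ j))"
    if k: "k \<in> A" "k' \<in> A" "k \<noteq> k'" for k k'
  proof -
    obtain i where i: "\<not> (int CARD('k) - 1) dvd (k $ i - k' $ i)" using incong k by blast
    then obtain a :: 'k where a: "a \<noteq> 0" "a powi (k $ i - k' $ i) \<noteq> 1"
      using finite_field_exponent by blast
    \<comment> \<open>One coordinate different from 1 isolates the exponent in which the two
      monomials differ modulo q - 1.\<close>
    define y where "y j = (if j = i then a else 1)" for j
    have prod_y: "(\<Prod>j\<in>UNIV. to_ac (y j) powi (m $ j)) = to_ac a powi (m $ i)" for m :: "int ^ 'n"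
    proof -
      have "(\<Prod>j\<in>UNIV. to_ac (y j) powi (m $ j)) = (\<Prod>j\<in>UNIV. if j = i then to_ac a powi (m $ i) else 1)"
        by (intro prod.cong) (auto simp: y_def)
      then show ?thesis by simp
    qed
    have "to_ac a powi (k $ i) \<noteq> to_ac a powi (k' $ i)"
    proof
      assume "to_ac a powi (k $ i) = to_ac a powi (k' $ i)"
      then have "to_ac a powi (k $ i - k' $ i) = 1" using a(1) by (simp add: power_int_diff)
      moreover have "to_ac a powi n = to_ac (a powi n)" for n
        by (simp add: power_int_def)
      ultimately show False using a(2) by simp
    qed
    then show ?thesis using a(1) unfolding prod_y[symmetric]
      by (intro bexI[of _ y]) (auto simp: y_def)
  qed
qed (use zero k in \<open>auto simp: power_int_mult_distrib prod.distrib\<close>)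

text \<open>Gaussian elimination on the equations \<open>W\<close>: an unknown \<open>k0\<close>
  with nonzero coefficient at \<open>w\<close> is the pivot, is eliminated from the other equations,
  and is recovered as \<open>d0\<close> by back substitution.\<close>

lemma underdetermined_system_solution:
  fixes h :: "'i \<Rightarrow> 'x \<Rightarrow> 'f :: field"
  assumes "finite W" "finite S" "card W < card S"
  shows "\<exists>d. (\<exists>k\<in>S. d k \<noteq> 0) \<and> (\<forall>x\<in>W. (\<Sum>k\<in>S. d k * h k x) = 0)"
  using assms
proof (induction W arbitrary: S h rule: finite_induct)
  case empty
  then obtain k where "k \<in> S" by fastforce
  then show ?case by (intro exI[of _ "\<lambda>_. 1"]) auto
next
  case (insert w W)
  show ?case
  proof (cases "\<forall>k\<in>S. h k w = 0")
    case True
    obtain d where "\<exists>k\<in>S. d k \<noteq> 0" "\<forall>x\<in>W. (\<Sum>k\<in>S. d k * h k x) = 0"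
      using insert.IH[of S h] insert.prems insert.hyps by auto
    then show ?thesis using True by (intro exI[of _ d]) auto
  next
    case False
    then obtain k0 where k0: "k0 \<in> S" "h k0 w \<noteq> 0" by blast
    define S' where "S' = S - {k0}"
    have S': "finite S'" "k0 \<notin> S'" "S = insert k0 S'" using insert.prems k0 by (auto simp: S'_def)
    have "card W < card S'" using insert.prems insert.hyps S' by simp
    then obtain d where d: "\<exists>k\<in>S'. d k \<noteq> 0"
      "\<forall>x\<in>W. (\<Sum>k\<in>S'. d k * (h k x - h k w / h k0 w * h k0 x)) = 0"
      using insert.IH[of S' "\<lambda>k x. h k x - h k w / h k0 w * h k0 x"] S' by blast
    define d0 where "d0 = - (\<Sum>k\<in>S'. d k * h k w / h k0 w)"
    define d' where "d' = d(k0 := d0)"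
    have sum_d': "(\<Sum>k\<in>S. d' k * h k x) = (\<Sum>k\<in>S'. d k * (h k x - h k w / h k0 w * h k0 x))" for x
    proof -
      have "(\<Sum>k\<in>S. d' k * h k x) = d0 * h k0 x + (\<Sum>k\<in>S'. d' k * h k x)"
        using S' by (simp add: d'_def)
      also have "(\<Sum>k\<in>S'. d' k * h k x) = (\<Sum>k\<in>S'. d k * h k x)"
        using S'(2) by (intro sum.cong) (auto simp: d'_def)
      finally show ?thesis
        by (simp add: d0_def sum_distrib_left sum_distrib_right sum_subtractf right_diff_distrib mult_ac)
    qed
    have "\<exists>k\<in>S. d' k \<noteq> 0" using d(1) S' by (auto simp: d'_def)
    moreover have "\<forall>x\<in>insert w W. (\<Sum>k\<in>S. d' k * h k x) = 0"
      using d(2) k0(2) by (simp add: sum_d')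
    ultimately show ?thesis by blast
  qed
qed

lemma additive_total_order_min:
  fixes A :: "'b :: ab_group_add set"
  assumes "additive_total_order lt" "finite A" "A \<noteq> {}"
  shows "\<exists>m\<in>A. \<forall>x\<in>A. x \<noteq> m \<longrightarrow> lt m x" and "\<exists>m\<in>A. \<forall>x\<in>A. x \<noteq> m \<longrightarrow> lt x m"
proof -
  have o: "asymp_on A lt" "transp_on A lt" and t: "totalp lt"
    using assms(1) by (auto simp: additive_total_order_def asymp_on_def irreflp_def transp_def transp_on_def)
  show "\<exists>m\<in>A. \<forall>x\<in>A. x \<noteq> m \<longrightarrow> lt m x"
    using Finite_Set.bex_min_element[OF assms(2) o assms(3)] t by (metis totalpD)
  show "\<exists>m\<in>A. \<forall>x\<in>A. x \<noteq> m \<longrightarrow> lt x m"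
    using Finite_Set.bex_max_element[OF assms(2) o assms(3)] t by (metis totalpD)
qed

section \<open>Values of sections in terms of lattice points\<close>

definition section_value ::
  "(real ^ 'n) set \<Rightarrow> (real ^ 'n) set \<Rightarrow> int ^ 'n \<Rightarrow> ('n, 'k :: field) coords \<Rightarrow> 'k alg_closure" where
  "section_value P P' m x = (\<Prod>F\<in>facets P. x F ^ nat (divisor_order P P' m F))"

lemma eval_poly_superset:
  assumes "finite A" "Poly_Mapping.keys f \<subseteq> A"
  shows "eval_poly P f x = (\<Sum>e\<in>A. to_ac (Poly_Mapping.lookup f e) * (\<Prod>F \<in> facets P. x F ^ Poly_Mapping.lookup e F))"
  unfolding eval_poly_def using assms
  by (intro sum.mono_neutral_left) (auto simp: in_keys_iff)

lemma eval_poly_add: "eval_poly P (f + g) x = eval_poly P f x + eval_poly P g x"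
proof -
  let ?A = "Poly_Mapping.keys f \<union> Poly_Mapping.keys g"
  have "eval_poly P h x = (\<Sum>e\<in>?A. to_ac (Poly_Mapping.lookup h e) * (\<Prod>F \<in> facets P. x F ^ Poly_Mapping.lookup e F))"
    if "h \<in> {f, g, f + g}" for h
    using that Poly_Mapping.keys_add[of f g] by (intro eval_poly_superset) auto
  then show ?thesis by (simp add: lookup_add distrib_right sum.distrib)
qed

lemma eval_poly_sum: "finite A \<Longrightarrow> eval_poly P (\<Sum>a\<in>A. f a) x = (\<Sum>a\<in>A. eval_poly P (f a) x)"
  by (induction A rule: finite_induct) (auto simp: eval_poly_add, simp add: eval_poly_def)

lemma eval_poly_single:
  "eval_poly P (Poly_Mapping.single e c) x = to_ac c * (\<Prod>F \<in> facets P. x F ^ Poly_Mapping.lookup e F)"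
  by (subst eval_poly_superset[of "{e}"]) auto

lemma lookup_monomial_exponent:
  assumes "finite (facets P)" "F \<in> facets P"
  shows "Poly_Mapping.lookup (monomial_exponent P P' m) F = nat (divisor_order P P' m F)"
  using assms
  by (simp add: monomial_exponent_def lookup_sum lookup_single when_def divisor_order_def pairing_def)

lemma eval_section:
  assumes "finite (facets P)" "finite (lattice_points P')"
  shows "eval_poly P (\<Sum>m \<in> lattice_points P'. Poly_Mapping.single (monomial_exponent P P' m) (c m)) x
    = (\<Sum>m \<in> lattice_points P'. to_ac (c m) * section_value P P' m x)"
  using assms by (simp add: eval_poly_sum eval_poly_single section_value_def lookup_monomial_exponent)

lemma prod_powi_sum:
  fixes a :: "'f :: field"
  assumes "a \<noteq> 0"
  shows "a powi (\<Sum>j\<in>J. f j) = (\<Prod>j\<in>J. a powi f j)"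
  using assms by (induction J rule: infinite_finite_induct) (auto simp: power_int_add)

lemma prod_powi:
  fixes a :: "'i \<Rightarrow> 'f :: field"
  shows "(\<Prod>j\<in>J. a j) powi n = (\<Prod>j\<in>J. a j powi n)"
  by (induction J rule: infinite_finite_induct) (auto simp: power_int_mult_distrib)

section \<open>Reduced monomials on the rational points\<close>

lemma prod_powi_pairing:
  fixes s :: "('n :: finite, 'k :: field) coords"
  assumes "\<And>F. F \<in> facets P \<Longrightarrow> s F \<noteq> 0"
  shows "(\<Prod>F\<in>facets P. s F powi pairing a (facet_normal P F))
    = (\<Prod>j\<in>UNIV. (\<Prod>F\<in>facets P. s F powi (facet_normal P F $ j)) powi (a $ j))"
proof -
  have "(\<Prod>F\<in>facets P. s F powi pairing a (facet_normal P F))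
    = (\<Prod>F\<in>facets P. \<Prod>j\<in>UNIV. (s F powi (facet_normal P F $ j)) powi (a $ j))"
    using assms by (intro prod.cong refl) (simp add: pairing_def prod_powi_sum mult.commute flip: power_int_mult)
  also have "\<dots> = (\<Prod>j\<in>UNIV. (\<Prod>F\<in>facets P. s F powi (facet_normal P F $ j)) powi (a $ j))"
    by (subst prod.swap) (simp add: prod_powi)
  finally show ?thesis .
qed

lemma torus_group_nonzero: "t \<in> torus_group P \<Longrightarrow> F \<in> facets P \<Longrightarrow> t F \<noteq> 0"
  by (auto simp: torus_group_def)

lemma torus_group_character:
  assumes "t \<in> torus_group P"
  shows "(\<Prod>F\<in>facets P. t F powi pairing a (facet_normal P F)) = 1"
  using assms by (subst prod_powi_pairing) (auto simp: torus_group_def)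

context polytope_pair
begin

section \<open>Reduced lattice points\<close>

lemma red_point_spec:
  assumes ord: "additive_total_order lt" and m: "m \<in> lattice_points P'"
  shows "red_point q lt P' m \<in> lattice_points P'" "red_equiv q P' m (red_point q lt P' m)"
    "\<And>b. b \<in> lattice_points P' \<Longrightarrow> red_equiv q P' m b \<Longrightarrow> b \<noteq> red_point q lt P' m \<Longrightarrow> lt (red_point q lt P' m) b"
proof -
  let ?S = "\<lambda>a. a \<in> lattice_points P' \<and> red_equiv q P' m a \<and>
     (\<forall>b\<in>lattice_points P'. red_equiv q P' m b \<and> b \<noteq> a \<longrightarrow> lt a b)"
  let ?A = "{a \<in> lattice_points P'. red_equiv q P' m a}"
  have "m \<in> ?A" using m by (simp add: red_equiv_iff)
  then obtain a where a: "?S a"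
    using additive_total_order_min(1)[OF ord, of ?A] finite_lattice_points' by auto
  have asym: "\<not> (lt a b \<and> lt b a)" for a b
    using ord unfolding additive_total_order_def irreflp_def transp_def by blast
  have "red_point q lt P' m = a"
    unfolding red_point_def
  proof (rule the_equality)
    show "?S a" by (rule a)
    fix b assume b: "?S b"
    show "b = a"
    proof (rule ccontr)
      assume "b \<noteq> a"
      then have "lt a b" "lt b a" using a b by simp_all
      then show False using asym by blast
    qed
  qed
  then show "red_point q lt P' m \<in> lattice_points P'" "red_equiv q P' m (red_point q lt P' m)"
    "\<And>b. b \<in> lattice_points P' \<Longrightarrow> red_equiv q P' m b \<Longrightarrow> b \<noteq> red_point q lt P' m \<Longrightarrow> lt (red_point q lt P' m) b"
    using a by auto
qed

lemma red_set_subset: "additive_total_order lt \<Longrightarrow> red_set q lt P' \<subseteq> lattice_points P'"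
  using red_point_spec(1) by (auto simp: red_set_def)

lemma finite_red_set: "finite (red_set q lt P')"
  unfolding red_set_def using finite_lattice_points' by simp

lemma red_set_unique:
  assumes ord: "additive_total_order lt" and ab: "a \<in> red_set q lt P'" "b \<in> red_set q lt P'"
    and equiv: "red_equiv q P' a b"
  shows "a = b"
proof (rule ccontr)
  assume neq: "a \<noteq> b"
  obtain m where m: "m \<in> lattice_points P'" "a = red_point q lt P' m" using ab(1) by (auto simp: red_set_def)
  obtain n where n: "n \<in> lattice_points P'" "b = red_point q lt P' n" using ab(2) by (auto simp: red_set_def)
  note ma = red_point_spec[OF ord m(1), where q = q, folded m(2)]
  note nb = red_point_spec[OF ord n(1), where q = q, folded n(2)]
  have "red_equiv q P' m b" "red_equiv q P' n a"
    using ma(2) nb(2) equiv m(1) n(1) ma(1) nb(1) unfolding red_equiv_iff[OF m(1) ma(1)]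
      red_equiv_iff[OF n(1) nb(1)] red_equiv_iff[OF ma(1) nb(1)] red_equiv_iff[OF m(1) nb(1)]
      red_equiv_iff[OF n(1) ma(1)]
    by (metis (no_types, opaque_lifting) dvd_add diff_add_cancel add_diff_eq, metis (no_types, opaque_lifting) dvd_diff diff_diff_eq2 diff_add_cancel add_diff_eq)
  then have "lt a b" "lt b a" using ma(3)[OF nb(1)] nb(3)[OF ma(1)] neq by auto
  then show False using ord unfolding additive_total_order_def irreflp_def transp_def by blast
qed

lemma red_point_in_red_set: "m \<in> lattice_points P' \<Longrightarrow> red_point q lt P' m \<in> red_set q lt P'"
  by (simp add: red_set_def)

lemma red_point_le:
  assumes "additive_total_order lt" "m \<in> lattice_points P'"
  shows "red_point q lt P' m = m \<or> lt (red_point q lt P' m) m"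
  using red_point_spec(3)[OF assms assms(2)] assms(2) by (metis red_equiv_iff diff_self dvd_0_right zero_index)

lemma red_point_fixed:
  assumes "additive_total_order lt" "m \<in> red_set q lt P'"
  shows "red_point q lt P' m = m"
proof -
  have m: "m \<in> lattice_points P'" using assms red_set_subset by blast
  then show ?thesis
    using red_set_unique[OF assms(1,2) red_point_in_red_set] red_point_spec(2)[OF assms(1) m] by metis
qed

section \<open>Monomials at normalized representatives of rational points\<close>

lemma representative_frobenius:
  fixes R :: "('n, 'k :: {field, finite}) coords set"
  assumes R: "is_rep_set P R" and x: "x \<in> R"
  obtains t where "t \<in> torus_group P" "\<And>F. F \<in> facets P \<Longrightarrow> x F ^ CARD('k) = t F * x F"
proof -
  obtain pt where pt: "pt \<in> rational_points P" "normalized_rep P pt x"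
    using R x unfolding is_rep_set_def by blast
  then have xpt: "x \<in> pt" and "pt \<in> toric_variety P" and frob: "frobenius P x \<in> pt"
    by (auto simp: rational_points_def normalized_rep_def)
  then obtain z where z: "pt = group_orbit P z" by (auto simp: toric_variety_def)
  obtain t1 where t1: "t1 \<in> torus_group P" "x = (\<lambda>F\<in>facets P. t1 F * z F)"
    using xpt by (auto simp: z group_orbit_def)
  obtain t2 where t2: "t2 \<in> torus_group P" "frobenius P x = (\<lambda>F\<in>facets P. t2 F * z F)"
    using frob by (auto simp: z group_orbit_def)
  \<comment> \<open>\<open>x\<close> and its Frobenius image both come from \<open>z\<close> by
    group elements; their quotient carries one to the other, whatever coordinates vanish.\<close>
  define t where "t = (\<lambda>F\<in>facets P. t2 F / t1 F)"
  have "(\<Prod>F\<in>facets P. t F powi (facet_normal P F $ j)) = 1" for j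
  proof -
    have "(\<Prod>F\<in>facets P. t F powi (facet_normal P F $ j)) =
      (\<Prod>F\<in>facets P. t2 F powi (facet_normal P F $ j)) / (\<Prod>F\<in>facets P. t1 F powi (facet_normal P F $ j))"
      by (simp add: t_def power_int_divide_distrib flip: prod_dividef)
    then show ?thesis using t1(1) t2(1) by (simp add: torus_group_def)
  qed
  then have "t \<in> torus_group P"
    using torus_group_nonzero[OF t1(1)] torus_group_nonzero[OF t2(1)] by (auto simp: torus_group_def t_def)
  moreover have "x F ^ CARD('k) = t F * x F" if F: "F \<in> facets P" for F
  proof -
    have "x F ^ CARD('k) = t2 F * z F" using fun_cong[OF t2(2), of F] F by (simp add: frobenius_def)
    then show ?thesis using fun_cong[OF t1(2), of F] F torus_group_nonzero[OF t1(1) F] by (simp add: t_def)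
  qed
  ultimately show ?thesis using that by blast
qed

lemma representative_vertex:
  fixes R :: "('n, 'k :: {field, finite}) coords set"
  assumes R: "is_rep_set P R" and x: "x \<in> R"
  obtains v where "v extreme_point_of P" "\<And>F. F \<in> facets P \<Longrightarrow> v \<notin> F \<Longrightarrow> x F = 1"
proof -
  obtain pt where "normalized_rep P pt x" using R x unfolding is_rep_set_def by blast
  then obtain Q v where "Q face_of P" "v extreme_point_of Q" "\<forall>F\<in>facets P. v \<notin> F \<longrightarrow> x F = 1"
    unfolding normalized_rep_def by blast
  then show ?thesis using that extreme_point_of_face by blast
qed

text \<open>Frobenius multiplies the value by a product of powers of t_F. Off the normalizing
  vertex, x_F = 1 forces t_F = 1, so the exponent there may be changed freely; at the facets through
  the vertex it is already the pairing with m - m0. The product is thus a character of G, hence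
  1.\<close>

lemma section_value_in_range_to_ac:
  fixes R :: "('n, 'k :: {field, finite}) coords set"
  assumes R: "is_rep_set P R" and x: "x \<in> R" and m: "m \<in> lattice_points P'"
  shows "section_value P P' m x \<in> range to_ac"
proof (rule frobenius_fixed_in_range_to_ac)
  obtain t where t: "t \<in> torus_group P" "\<And>F. F \<in> facets P \<Longrightarrow> x F ^ CARD('k) = t F * x F"
    using representative_frobenius[OF R x] by blast
  obtain v where v: "v extreme_point_of P" "\<And>F. F \<in> facets P \<Longrightarrow> v \<notin> F \<Longrightarrow> x F = 1"
    using representative_vertex[OF R x] by blast
  obtain m0 where m0: "\<And>F. F \<in> facets P \<Longrightarrow> v \<in> F \<Longrightarrow> divisor_order P P' m0 F = 0"
    using vertex_lattice_point[OF v(1)] by blast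
  have "section_value P P' m x ^ CARD('k) = (\<Prod>F\<in>facets P. (x F ^ CARD('k)) ^ nat (divisor_order P P' m F))"
    by (simp add: section_value_def mult.commute prod_power_distrib flip: power_mult)
  also have "\<dots> = (\<Prod>F\<in>facets P. t F ^ nat (divisor_order P P' m F)) * section_value P P' m x"
    by (simp add: t(2) power_mult_distrib prod.distrib section_value_def)
  also have "(\<Prod>F\<in>facets P. t F ^ nat (divisor_order P P' m F)) = (\<Prod>F\<in>facets P. t F powi pairing (m - m0) (facet_normal P F))"
  proof (intro prod.cong refl)
    fix F assume F: "F \<in> facets P"
    show "t F ^ nat (divisor_order P P' m F) = t F powi pairing (m - m0) (facet_normal P F)"
    proof (cases "v \<in> F")
      case True
      then have "pairing (m - m0) (facet_normal P F) = divisor_order P P' m F"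
        using m0[OF F True] by (simp add: divisor_order_def pairing_diff)
      moreover have "divisor_order P P' m F \<ge> 0" using m F lattice_points_iff_divisor_order_nonneg by blast
      ultimately show ?thesis by (simp add: power_int_def)
    next
      case False
      then have "t F = 1" using t(2)[OF F] v(2)[OF F False] by simp
      then show ?thesis by simp
    qed
  qed
  also have "\<dots> = 1" using torus_group_character[OF t(1)] .
  finally show "section_value P P' m x ^ CARD('k) = section_value P P' m x" by simp
qed

text \<open>At a nonzero coordinate x_F^(q-1) = t_F, so changing the exponents by multiples of q - 1
  multiplies the value by a character of G, which is 1. At a zero coordinate the common set of tight
  facets decides: either both values vanish or both exponents are 0.\<close>

lemma section_value_congruent:
  fixes R :: "('n, 'k :: {field, finite}) coords set"
  assumes R: "is_rep_set P R" and x: "x \<in> R"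
    and m: "m \<in> lattice_points P'" "m' \<in> lattice_points P'" "red_equiv CARD('k) P' m m'"
  shows "section_value P P' m x = section_value P P' m' x"
proof -
  have q: "CARD('k) \<ge> 2" by (rule card_field_ge_2)
  have tight: "tight_facets P P' m = tight_facets P P' m'"
    and cong: "\<forall>i. (int CARD('k) - 1) dvd (m $ i - m' $ i)"
    using m red_equiv_iff by auto
  show ?thesis
  proof (cases "\<exists>F\<in>facets P. x F = 0 \<and> F \<notin> tight_facets P P' m")
    case True
    then obtain F where F: "F \<in> facets P" "x F = 0" "F \<notin> tight_facets P P' m" by blast
    have "section_value P P' n x = 0" if n: "n \<in> lattice_points P'" "F \<notin> tight_facets P P' n" for n
    proof -
      have "divisor_order P P' n F > 0"
        using n F(1) lattice_points_iff_divisor_order_nonneg[of n] by (force simp: tight_facets_def)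
      then have "x F ^ nat (divisor_order P P' n F) = 0" using F(2) by simp
      then show ?thesis using F(1) finite_facets by (auto simp: section_value_def intro!: prod_zero)
    qed
    then show ?thesis using m F(3) tight by metis
  next
    case False
    obtain t where t: "t \<in> torus_group P" "\<And>F. F \<in> facets P \<Longrightarrow> x F ^ CARD('k) = t F * x F"
      using representative_frobenius[OF R x] by blast
    obtain a where a: "\<And>i. m $ i - m' $ i = (int CARD('k) - 1) * a i"
      using cong unfolding dvd_def by metis
    define k where "k F = pairing (\<chi> i. a i) (facet_normal P F)" for F
    have k: "divisor_order P P' m F = divisor_order P P' m' F + (int CARD('k) - 1) * k F" for F
    proof -
      have "pairing (m - m') (facet_normal P F) = (int CARD('k) - 1) * k F"
        by (simp add: pairing_def k_def a sum_distrib_left mult_ac)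
      then show ?thesis by (simp add: divisor_order_def pairing_diff)
    qed
    have "section_value P P' m x = (\<Prod>F\<in>facets P. x F ^ nat (divisor_order P P' m' F) * t F powi k F)"
      unfolding section_value_def
    proof (intro prod.cong refl)
      fix F assume F: "F \<in> facets P"
      have nonneg: "divisor_order P P' m F \<ge> 0" "divisor_order P P' m' F \<ge> 0"
        using m F lattice_points_iff_divisor_order_nonneg by blast+
      show "x F ^ nat (divisor_order P P' m F) = x F ^ nat (divisor_order P P' m' F) * t F powi k F"
      proof (cases "x F = 0")
        case True
        then have "F \<in> tight_facets P P' m" "F \<in> tight_facets P P' m'" using False F tight by auto
        then have e: "divisor_order P P' m F = 0" "divisor_order P P' m' F = 0" by (auto simp: tight_facets_def)
        \<comment> \<open>Since q - 1 is nonzero, equal exponents leave no power of t_F, and both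
          sides are 0^0 = 1.\<close>
        then have "k F = 0" using k[of F] q by simp
        then show ?thesis using e by simp
      next
        case x0: False
        have "x F * x F ^ (CARD('k) - 1) = t F * x F" using t(2)[OF F] q by (simp flip: power_Suc)
        then have "x F ^ (CARD('k) - 1) = t F" using x0 by simp
        then have tF: "x F powi (int CARD('k) - 1) = t F"
          using q by (simp add: of_nat_diff flip: power_int_of_nat)
        have "x F ^ nat (divisor_order P P' m F) = x F powi divisor_order P P' m F"
          using nonneg by (simp add: power_int_def)
        also have "\<dots> = x F powi divisor_order P P' m' F * (x F powi (int CARD('k) - 1)) powi k F"
          using x0 by (simp add: k power_int_add power_int_mult)
        also have "x F powi divisor_order P P' m' F = x F ^ nat (divisor_order P P' m' F)"
          using nonneg by (simp add: power_int_def)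
        finally show ?thesis by (simp add: tF)
      qed
    qed
    also have "\<dots> = section_value P P' m' x * (\<Prod>F\<in>facets P. t F powi k F)"
      by (simp add: prod.distrib section_value_def)
    also have "(\<Prod>F\<in>facets P. t F powi k F) = 1"
      unfolding k_def using torus_group_character[OF t(1)] .
    finally show ?thesis by simp
  qed
qed

text \<open>An integer matrix inverts the monomial system at \<open>v\<close> up to a factor \<open>d\<close>, which is absorbed
  by extracting \<open>d\<close>-th roots in the algebraic closure.\<close>

lemma torus_point_above:
  fixes y :: "'n \<Rightarrow> 'k :: field"
  assumes v: "v extreme_point_of P" and y: "\<And>j. y j \<noteq> 0"
  obtains s :: "('n, 'k) coords" where "\<And>F. s F \<noteq> 0" "\<And>F. v \<notin> F \<Longrightarrow> s F = 1"
    "\<And>j. (\<Prod>F\<in>facets P. s F powi (facet_normal P F $ j)) = to_ac (y j)"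
proof -
  obtain b :: "'n \<Rightarrow> (real ^ 'n) set" where b: "bij_betw b UNIV {F \<in> facets P. v \<in> F}"
    and det: "det (\<chi> i. facet_normal P (b i)) \<noteq> 0"
    using vertex_matrix[OF v] by blast
  define A where "A = (\<chi> i. facet_normal P (b i))"
  obtain B d where Bd: "d > 0" "B ** A = mat d"
    using nonsingular_int_matrix_scaled_inverse det unfolding A_def by blast
  have "\<forall>l. \<exists>w. w ^ nat d = to_ac (y l)" using Bd(1) nth_root_exists[of "nat d"] by auto
  then obtain w where w: "\<And>l. w l ^ nat d = to_ac (y l)" by metis
  have w0: "w l \<noteq> 0" for l
  proof
    assume "w l = 0"
    then have "to_ac (y l) = 0" using w[of l] Bd(1) by (simp add: power_0_left)
    then show False using y by simp
  qed
  define \<xi> where "\<xi> i = (\<Prod>l\<in>UNIV. w l powi (B $ l $ i))" for i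
  have \<xi>: "(\<Prod>i\<in>UNIV. \<xi> i powi (A $ i $ j)) = to_ac (y j)" for j
  proof -
    have "(\<Prod>i\<in>UNIV. \<xi> i powi (A $ i $ j)) = (\<Prod>l\<in>UNIV. \<Prod>i\<in>UNIV. w l powi (B $ l $ i * A $ i $ j))"
      unfolding \<xi>_def by (subst prod.swap) (simp add: prod_powi power_int_mult)
    also have "\<dots> = (\<Prod>l\<in>UNIV. w l powi ((B ** A) $ l $ j))"
      using w0 by (simp add: matrix_matrix_mult_def prod_powi_sum)
    also have "\<dots> = (\<Prod>l\<in>UNIV. if l = j then w j powi d else 1)"
      by (intro prod.cong) (auto simp: Bd(2) mat_def)
    also have "\<dots> = to_ac (y j)" using Bd(1) w[of j] by (simp add: power_int_def)
    finally show ?thesis .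
  qed
  define s where "s F = (if v \<in> F then \<xi> (inv_into UNIV b F) else 1)" for F
  have "s F \<noteq> 0" for F using w0 by (simp add: s_def \<xi>_def)
  moreover have "(\<Prod>F\<in>facets P. s F powi (facet_normal P F $ j)) = to_ac (y j)" for j
  proof -
    have "(\<Prod>F\<in>facets P. s F powi (facet_normal P F $ j))
      = (\<Prod>F\<in>{F \<in> facets P. v \<in> F}. s F powi (facet_normal P F $ j))"
      by (intro prod.mono_neutral_right finite_facets) (auto simp: s_def)
    also have "\<dots> = (\<Prod>i\<in>UNIV. s (b i) powi (facet_normal P (b i) $ j))"
      by (rule prod.reindex_bij_betw[OF b, symmetric])
    also have "\<dots> = (\<Prod>i\<in>UNIV. \<xi> i powi (A $ i $ j))"
    proof (intro prod.cong refl)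
      fix i
      have "b i \<in> {F \<in> facets P. v \<in> F}" using b by (auto simp: bij_betw_def)
      moreover have "inv_into UNIV b (b i) = i" using b by (simp add: bij_betw_def inv_into_f_f)
      ultimately show "s (b i) powi (facet_normal P (b i) $ j) = \<xi> i powi (A $ i $ j)"
        by (simp add: s_def A_def)
    qed
    finally show ?thesis using \<xi> by simp
  qed
  ultimately show ?thesis by (intro that[of s]) (auto simp: s_def)
qed

text \<open>\<open>z\<close> is a torus point above \<open>y\<close> with the coordinates in
  \<open>T\<close> set to zero. \<open>R\<close> contains some x = t z from its orbit, not
  necessarily \<open>z\<close>; the resulting factor \<open>l\<close>, built from the support
  numbers, is the same for all monomials and so is harmless in linear relations.\<close>

lemma exists_representative:
  fixes R :: "('n, 'k :: {field, finite}) coords set" and y :: "'n \<Rightarrow> 'k"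
  assumes R: "is_rep_set P R" and v: "v extreme_point_of P" and y: "\<And>j. y j \<noteq> 0"
    and T: "T \<subseteq> {F \<in> facets P. v \<in> F}"
    and m0: "\<And>F. F \<in> facets P \<Longrightarrow> v \<in> F \<Longrightarrow> divisor_order P P' m0 F = 0"
  obtains x l where "x \<in> R" "l \<noteq> 0"
    "\<And>m. m \<in> lattice_points P' \<Longrightarrow> section_value P P' m x =
      l * (if T \<subseteq> tight_facets P P' m then (\<Prod>j\<in>UNIV. to_ac (y j) powi (m $ j - m0 $ j)) else 0)"
proof -
  have q: "CARD('k) \<ge> 2" by (rule card_field_ge_2)
  obtain s :: "('n, 'k) coords" where s: "\<And>F. s F \<noteq> 0" "\<And>F. v \<notin> F \<Longrightarrow> s F = 1"
    "\<And>j. (\<Prod>F\<in>facets P. s F powi (facet_normal P F $ j)) = to_ac (y j)"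
    using torus_point_above[OF v, where 'k = 'k and y = y] y by metis
  define z where "z = (\<lambda>F\<in>facets P. if F \<in> T then 0 else s F)"
  \<comment> \<open>The vertex \<open>v\<close> witnesses that \<open>z\<close> is off the
    irrelevant locus: all coordinates at facets not through it are 1.\<close>
  have "(\<Prod>F\<in>{F \<in> facets P. v \<notin> F}. z F) = 1"
    using T s(2) by (intro prod.neutral) (auto simp: z_def)
  then have "z \<in> (facets P \<rightarrow>\<^sub>E UNIV) - irrelevant_locus P"
    using v by (auto simp: irrelevant_locus_def z_def)
  then have variety: "group_orbit P z \<in> toric_variety P" by (simp add: toric_variety_def)
  have "frobenius P x \<in> group_orbit P z" if x: "x \<in> group_orbit P z" for x
  proof -
    obtain t where t: "t \<in> torus_group P" "x = (\<lambda>F\<in>facets P. t F * z F)"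
      using x by (auto simp: group_orbit_def)
    \<comment> \<open>The factor s_F^(q-1) is kept even where z_F = 0, because only the product over
      all facets equals y_j^(q-1) = 1.\<close>
    define t' where "t' = (\<lambda>F\<in>facets P. t F ^ CARD('k) * s F ^ (CARD('k) - 1))"
    have "(\<Prod>F\<in>facets P. t' F powi (facet_normal P F $ j)) = 1" for j
    proof -
      have pc: "(a ^ n) powi i = (a powi i) ^ n" for a :: "'k alg_closure" and n i
        by (metis power_int_mult power_int_of_nat mult.commute)
      have "(\<Prod>F\<in>facets P. t' F powi (facet_normal P F $ j))
        = (\<Prod>F\<in>facets P. t F powi (facet_normal P F $ j)) ^ CARD('k)
          * (\<Prod>F\<in>facets P. s F powi (facet_normal P F $ j)) ^ (CARD('k) - 1)"
        by (simp add: t'_def power_int_mult_distrib prod.distrib pc prod_power_distrib)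
      also have "\<dots> = to_ac (y j ^ (CARD('k) - 1))"
        using t(1) by (simp add: torus_group_def s(3))
      finally show ?thesis unfolding finite_field_power_card_minus_1[OF y] by simp
    qed
    then have "t' \<in> torus_group P"
      using torus_group_nonzero[OF t(1)] s(1) by (auto simp: torus_group_def t'_def)
    moreover have "frobenius P x = (\<lambda>F\<in>facets P. t' F * z F)"
    proof -
      have "s F ^ CARD('k) = s F ^ (CARD('k) - 1) * s F" for F
        using q by (simp flip: power_Suc2)
      then show ?thesis
        unfolding frobenius_def t(2) using q
        by (intro restrict_ext) (auto simp: t'_def z_def power_mult_distrib power_0_left)
    qed
    ultimately show ?thesis by (auto simp: group_orbit_def)
  qed
  then have "group_orbit P z \<in> rational_points P" using variety by (auto simp: rational_points_def)
  then obtain x where x: "x \<in> R" "x \<in> group_orbit P z"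
    using R unfolding is_rep_set_def by blast
  then obtain t where t: "t \<in> torus_group P" "x = (\<lambda>F\<in>facets P. t F * z F)"
    by (auto simp: group_orbit_def)
  define l where "l = (\<Prod>F\<in>facets P. t F powi support_numbers P P' F)"
  have "l \<noteq> 0" using torus_group_nonzero[OF t(1)] finite_facets by (simp add: l_def)
  moreover have "section_value P P' m x =
      l * (if T \<subseteq> tight_facets P P' m then (\<Prod>j\<in>UNIV. to_ac (y j) powi (m $ j - m0 $ j)) else 0)"
    if m: "m \<in> lattice_points P'" for m
  proof -
    have nonneg: "divisor_order P P' m F \<ge> 0" if "F \<in> facets P" for F
      using m that lattice_points_iff_divisor_order_nonneg by blast
    have "section_value P P' m x = (\<Prod>F\<in>facets P. t F ^ nat (divisor_order P P' m F))
        * (\<Prod>F\<in>facets P. z F ^ nat (divisor_order P P' m F))"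
      by (simp add: section_value_def t(2) power_mult_distrib prod.distrib)
    also have "(\<Prod>F\<in>facets P. t F ^ nat (divisor_order P P' m F))
        = (\<Prod>F\<in>facets P. t F powi pairing m (facet_normal P F) * t F powi support_numbers P P' F)"
    proof (intro prod.cong refl)
      fix F assume F: "F \<in> facets P"
      have "t F ^ nat (divisor_order P P' m F) = t F powi divisor_order P P' m F"
        using nonneg[OF F] by (simp add: power_int_def)
      then show "t F ^ nat (divisor_order P P' m F)
          = t F powi pairing m (facet_normal P F) * t F powi support_numbers P P' F"
        using torus_group_nonzero[OF t(1) F] by (simp add: divisor_order_def power_int_add)
    qed
    also have "\<dots> = l" using torus_group_character[OF t(1), of m] by (simp add: prod.distrib l_def)
    also have "(\<Prod>F\<in>facets P. z F ^ nat (divisor_order P P' m F))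
        = (if T \<subseteq> tight_facets P P' m then (\<Prod>j\<in>UNIV. to_ac (y j) powi (m $ j - m0 $ j)) else 0)"
    proof (cases "T \<subseteq> tight_facets P P' m")
      case True
      have "(\<Prod>F\<in>facets P. z F ^ nat (divisor_order P P' m F))
          = (\<Prod>F\<in>facets P. s F powi pairing (m - m0) (facet_normal P F))"
      proof (intro prod.cong refl)
        fix F assume F: "F \<in> facets P"
        have "z F ^ nat (divisor_order P P' m F) = s F powi divisor_order P P' m F"
          using True F nonneg[OF F] by (auto simp: z_def tight_facets_def power_int_def)
        also have "\<dots> = s F powi pairing (m - m0) (facet_normal P F)"
        proof (cases "v \<in> F")
          case True
          then have "divisor_order P P' m F = pairing (m - m0) (facet_normal P F)"
            using m0[OF F True] by (simp add: divisor_order_def pairing_diff)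
          then show ?thesis by simp
        qed (simp add: s(2))
        finally show "z F ^ nat (divisor_order P P' m F) = s F powi pairing (m - m0) (facet_normal P F)" .
      qed
      also have "\<dots> = (\<Prod>j\<in>UNIV. to_ac (y j) powi (m $ j - m0 $ j))"
        by (subst prod_powi_pairing) (simp_all add: s)
      finally show ?thesis using True by simp
    next
      case False
      then obtain F where F: "F \<in> T" "F \<in> facets P" "F \<notin> tight_facets P P' m" using T by blast
      then have "divisor_order P P' m F > 0" using nonneg[OF F(2)] by (auto simp: tight_facets_def)
      then have "z F ^ nat (divisor_order P P' m F) = 0" using F by (simp add: z_def)
      then show ?thesis using False F(2) finite_facets by (auto intro!: prod_zero)
    qed
    finally show ?thesis .
  qed
  ultimately show ?thesis using that x(1) by blast
qed

lemma red_set_linearly_independent: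
  fixes R :: "('n, 'k :: {field, finite}) coords set" and c :: "int ^ 'n \<Rightarrow> 'k alg_closure"
  assumes R: "is_rep_set P R" and ord: "additive_total_order lt"
    and zero: "\<And>x. x \<in> R \<Longrightarrow> (\<Sum>k\<in>red_set CARD('k) lt P'. c k * section_value P P' k x) = 0"
    and "k \<in> red_set CARD('k) lt P'"
  shows "c k = 0"
proof (rule ccontr)
  assume "c k \<noteq> 0"
  text \<open>Choosing \<open>k0\<close> with as many tight facets as possible, only the monomials in the relative
    interior of the same face survive at the points vanishing exactly along these facets.\<close>
  define S where "S = {k \<in> red_set CARD('k) lt P'. c k \<noteq> 0}"
  have finS: "finite S" using finite_red_set by (simp add: S_def)
  have "k \<in> S" using assms(4) \<open>c k \<noteq> 0\<close> by (simp add: S_def)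
  then have "Max ((\<lambda>k. card (tight_facets P P' k)) ` S) \<in> (\<lambda>k. card (tight_facets P P' k)) ` S"
    using finS by (intro Max_in) auto
  then obtain k0 where k0: "k0 \<in> S" "Max ((\<lambda>k. card (tight_facets P P' k)) ` S) = card (tight_facets P P' k0)"
    by blast
  have max: "card (tight_facets P P' k) \<le> card (tight_facets P P' k0)" if "k \<in> S" for k
    unfolding k0(2)[symmetric] using that finS by (intro Max_ge) auto
  define T where "T = tight_facets P P' k0"
  have L: "red_set CARD('k) lt P' \<subseteq> lattice_points P'" using red_set_subset[OF ord] .
  have k0L: "k0 \<in> lattice_points P'" using k0 L by (auto simp: S_def)
  obtain v where v: "v extreme_point_of P" "\<And>F. F \<in> T \<Longrightarrow> v \<in> F"
    using tight_facets_at_vertex[OF k0L] unfolding T_def by blast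
  have T: "T \<subseteq> {F \<in> facets P. v \<in> F}" using v(2) by (auto simp: T_def tight_facets_def)
  obtain m0 where m0: "\<And>F. F \<in> facets P \<Longrightarrow> v \<in> F \<Longrightarrow> divisor_order P P' m0 F = 0"
    using vertex_lattice_point[OF v(1)] by blast
  define A where "A = {k \<in> S. tight_facets P P' k = T}"
  \<comment> \<open>Maximality of the number of tight facets turns the inclusion into an
    equality.\<close>
  have A: "k \<in> A" if "k \<in> S" "T \<subseteq> tight_facets P P' k" for k
  proof -
    have "finite (tight_facets P P' k)" using finite_facets by (simp add: tight_facets_def)
    then have "T = tight_facets P P' k" using that(2) max[OF that(1)] card_seteq unfolding T_def by metis
    then show ?thesis using that(1) by (simp add: A_def)
  qed
  have "c k0 = 0"
  proof (rule monomials_linearly_independent[where A = A and c = c])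
    show "finite A" using finS by (simp add: A_def)
    show "k = k'" if "k \<in> A" "k' \<in> A" "\<forall>i. (int CARD('k) - 1) dvd (k $ i - k' $ i)" for k k'
    proof (rule red_set_unique[OF ord])
      show "k \<in> red_set CARD('k) lt P'" "k' \<in> red_set CARD('k) lt P'" using that by (auto simp: A_def S_def)
      then show "red_equiv CARD('k) P' k k'"
        using that L by (subst red_equiv_iff) (auto simp: A_def)
    qed
    show "k0 \<in> A" using k0 by (simp add: A_def T_def)
    fix y :: "'n \<Rightarrow> 'k" assume y: "\<And>j. y j \<noteq> 0"
    show "(\<Sum>k\<in>A. c k * (\<Prod>j\<in>UNIV. to_ac (y j) powi (k $ j))) = 0"
    proof (rule exists_representative[OF R v(1) y T m0])
      fix x l assume x: "x \<in> R" "l \<noteq> 0" and val: "\<And>m. m \<in> lattice_points P' \<Longrightarrow> section_value P P' m x =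
        l * (if T \<subseteq> tight_facets P P' m then (\<Prod>j\<in>UNIV. to_ac (y j) powi (m $ j - m0 $ j)) else 0)"
      \<comment> \<open>The shift by \<open>m0\<close> contributes one factor common to all
        monomials, so it can be divided out together with \<open>l\<close>.\<close>
      define \<mu> where "\<mu> = (\<Prod>j\<in>UNIV. to_ac (y j) powi (m0 $ j))"
      have \<mu>: "\<mu> \<noteq> 0" using y by (simp add: \<mu>_def)
      have shift: "(\<Prod>j\<in>UNIV. to_ac (y j) powi (m $ j - m0 $ j)) = (\<Prod>j\<in>UNIV. to_ac (y j) powi (m $ j)) / \<mu>" for m :: "int ^ 'n"
        using y by (simp add: \<mu>_def power_int_diff prod_dividef)
      have "0 = (\<Sum>k\<in>red_set CARD('k) lt P'. c k * section_value P P' k x)" using zero[OF x(1)] by simp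
      also have "\<dots> = (\<Sum>k\<in>A. c k * section_value P P' k x)"
      proof (intro sum.mono_neutral_right finite_red_set ballI)
        show "A \<subseteq> red_set CARD('k) lt P'" by (auto simp: A_def S_def)
        fix k assume k: "k \<in> red_set CARD('k) lt P' - A"
        then have "k \<in> lattice_points P'" using L by blast
        moreover have "\<not> T \<subseteq> tight_facets P P' k" if "c k \<noteq> 0"
          using A[of k] k that by (auto simp: S_def)
        ultimately show "c k * section_value P P' k x = 0"
          by (cases "c k = 0") (simp_all add: val)
      qed
      also have "\<dots> = (\<Sum>k\<in>A. l / \<mu> * (c k * (\<Prod>j\<in>UNIV. to_ac (y j) powi (k $ j))))"
      proof (intro sum.cong refl)
        fix k assume k: "k \<in> A"
        then have "k \<in> lattice_points P'" "T \<subseteq> tight_facets P P' k" using L by (auto simp: A_def S_def)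
        then show "c k * section_value P P' k x = l / \<mu> * (c k * (\<Prod>j\<in>UNIV. to_ac (y j) powi (k $ j)))"
          by (simp add: val shift)
      qed
      also have "\<dots> = l / \<mu> * (\<Sum>k\<in>A. c k * (\<Prod>j\<in>UNIV. to_ac (y j) powi (k $ j)))"
        by (simp only: sum_distrib_left)
      finally have "l / \<mu> * (\<Sum>k\<in>A. c k * (\<Prod>j\<in>UNIV. to_ac (y j) powi (k $ j))) = 0" ..
      then show "(\<Sum>k\<in>A. c k * (\<Prod>j\<in>UNIV. to_ac (y j) powi (k $ j))) = 0"
        using x(2) \<mu> by (simp only: mult_eq_0_iff divide_eq_0_iff) simp
    qed
  qed
  then show False using k0 by (simp add: S_def)
qed

lemma section_value_reduce:
  fixes R :: "('n, 'k :: {field, finite}) coords set"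
  assumes "is_rep_set P R" "x \<in> R" "additive_total_order lt" "m \<in> lattice_points P'"
  shows "section_value P P' (red_point CARD('k) lt P' m) x = section_value P P' m x"
  using section_value_congruent[OF assms(1,2,4)] red_point_spec(1,2)[OF assms(3,4)] by metis

text \<open>The index set is arbitrary because distinct indices may share a lattice point or a
  reduction, as the pairs (k, m) of the final count do; their coefficients then add up.\<close>

lemma sum_reduce:
  fixes R :: "('n, 'k :: {field, finite}) coords set"
  assumes "is_rep_set P R" "x \<in> R" "additive_total_order lt"
    and "finite I" "\<And>i. i \<in> I \<Longrightarrow> g i \<in> lattice_points P'"
  shows "(\<Sum>i\<in>I. c i * section_value P P' (g i) x)
    = (\<Sum>k\<in>red_set CARD('k) lt P'. (\<Sum>i | i \<in> I \<and> red_point CARD('k) lt P' (g i) = k. c i) * section_value P P' k x)"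
proof -
  have "(\<Sum>i\<in>I. c i * section_value P P' (g i) x)
    = (\<Sum>i\<in>I. c i * section_value P P' (red_point CARD('k) lt P' (g i)) x)"
    using assms section_value_reduce[OF assms(1,2,3)] by (intro sum.cong) auto
  also have "\<dots> = (\<Sum>k\<in>red_set CARD('k) lt P'. \<Sum>i | i \<in> I \<and> red_point CARD('k) lt P' (g i) = k.
      c i * section_value P P' (red_point CARD('k) lt P' (g i)) x)"
    using assms red_point_in_red_set finite_red_set by (intro sum.group[symmetric]) auto
  also have "\<dots> = (\<Sum>k\<in>red_set CARD('k) lt P'. (\<Sum>i | i \<in> I \<and> red_point CARD('k) lt P' (g i) = k. c i) * section_value P P' k x)"
    unfolding sum_distrib_right by (intro sum.cong refl) auto
  finally show ?thesis .
qed

end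

section \<open>The minimum distance\<close>

lemma weight_ge_shifted_red_set:
  fixes P P' :: "(real ^ 'n) set" and R :: "('n, 'k :: {field, finite}) coords set"
    and c :: "int ^ 'n \<Rightarrow> 'k alg_closure" and lt :: "int ^ 'n \<Rightarrow> int ^ 'n \<Rightarrow> bool"
  defines "g \<equiv> \<lambda>x. \<Sum>m\<in>red_set CARD('k) lt P. c m * section_value P P m x"
  assumes P: "polytope_pair P P p" and P': "polytope_pair P P' p"
    and R: "is_rep_set P R" "finite R" and ord: "additive_total_order lt"
    and nz: "\<exists>m\<in>red_set CARD('k) lt P. c m \<noteq> 0"
  shows "\<exists>m\<in>red_set CARD('k) lt P.
    card ({k. emb k \<in> (+) (emb m) ` difference_polytope P P'} \<inter> red_set CARD('k) lt P') \<le> card {x \<in> R. g x \<noteq> 0}"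
proof -
  interpret P: polytope_pair P P p by (rule P)
  interpret P': polytope_pair P P' p by (rule P')
  define q where "q = CARD('k)"
  have trans: "lt a b \<Longrightarrow> lt b d \<Longrightarrow> lt a d" and irrefl: "\<not> lt a a"
    and lt_add: "lt a b \<Longrightarrow> lt (a + d) (b + d)" for a b d
    using ord unfolding additive_total_order_def transp_def irreflp_def by blast+
  define M where "M = {m \<in> red_set q lt P. c m \<noteq> 0}"
  have M: "finite M" "M \<noteq> {}" using nz P.finite_red_set by (auto simp: M_def q_def)
  obtain m0 where m0: "m0 \<in> M" and m0_max: "\<And>m. m \<in> M \<Longrightarrow> m \<noteq> m0 \<Longrightarrow> lt m m0"
    using additive_total_order_min(2)[OF ord M] by blast
  define S where "S = {k. emb k \<in> (+) (emb m0) ` difference_polytope P P'} \<inter> red_set q lt P'"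
  have finS: "finite S" using P'.finite_red_set by (auto simp: S_def)
  have S_pairing: "pairing (k - m0) (facet_normal P F) \<ge> - (support_numbers P P' F - support_numbers P P F)"
    if k: "k \<in> S" and F: "F \<in> facets P" for k F
  proof -
    obtain z where z: "z \<in> difference_polytope P P'" "emb k = emb m0 + z" using k by (auto simp: S_def)
    have "z = emb (k - m0)" using z(2) by (simp add: emb_diff)
    then have "real_of_int (pairing (k - m0) (facet_normal P F)) \<ge>
        real_of_int (- (support_numbers P P' F - support_numbers P P F))"
      using z(1) F by (auto simp: difference_polytope_def simp flip: emb_inner_emb)
    then show ?thesis by (simp only: of_int_le_iff)
  qed
  have ord_add: "divisor_order P P' (m + (k - m0)) F = divisor_order P P m F +
      (pairing (k - m0) (facet_normal P F) + (support_numbers P P' F - support_numbers P P F))" for k m F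
    by (simp add: divisor_order_def pairing_add)
  have shift_mem: "m + (k - m0) \<in> lattice_points P'" if "m \<in> red_set q lt P" "k \<in> S" for m k
  proof -
    have "m \<in> lattice_points P" using that(1) P.red_set_subset[OF ord] by blast
    then show ?thesis
      using S_pairing[OF that(2)] unfolding P'.lattice_points_iff_divisor_order_nonneg
        P.lattice_points_iff_divisor_order_nonneg ord_add
      by force
  qed
  \<comment> \<open>\<open>g\<close> times the monomial of k - m0 for the difference of the two
    divisors. Its exponents are nonnegative because k - m0 lies in the difference polytope.\<close>
  define h where "h k x = g x * (\<Prod>F\<in>facets P. x F ^ nat (pairing (k - m0) (facet_normal P F)
      + (support_numbers P P' F - support_numbers P P F)))" for k x
  have h: "h k x = (\<Sum>m\<in>red_set q lt P. c m * section_value P P' (m + (k - m0)) x)" if k: "k \<in> S" for k x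
    unfolding h_def g_def sum_distrib_right q_def[symmetric]
  proof (intro sum.cong refl)
    fix m assume m: "m \<in> red_set q lt P"
    then have "m \<in> lattice_points P" using P.red_set_subset[OF ord] by blast
    then have "section_value P P' (m + (k - m0)) x = section_value P P m x *
        (\<Prod>F\<in>facets P. x F ^ nat (pairing (k - m0) (facet_normal P F)
      + (support_numbers P P' F - support_numbers P P F)))"
      unfolding section_value_def prod.distrib[symmetric] ord_add
      using S_pairing[OF k] P.lattice_points_iff_divisor_order_nonneg[of m]
      by (intro prod.cong refl) (subst nat_add_distrib, force+, simp add: power_add)
    then show "c m * section_value P P m x * (\<Prod>F\<in>facets P. x F ^ nat (pairing (k - m0) (facet_normal P F)
      + (support_numbers P P' F - support_numbers P P F))) = c m * section_value P P' (m + (k - m0)) x"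
      by (simp add: mult.assoc)
  qed
  have "card S \<le> card {x \<in> R. g x \<noteq> 0}"
  proof (rule ccontr)
    assume "\<not> ?thesis"
    then obtain d where d: "\<exists>k\<in>S. d k \<noteq> 0" "\<forall>x\<in>{x \<in> R. g x \<noteq> 0}. (\<Sum>k\<in>S. d k * h k x) = 0"
      using underdetermined_system_solution[of "{x \<in> R. g x \<noteq> 0}" S h] R(2) finS by auto
    \<comment> \<open>Each \<open>h k\<close> is a multiple of \<open>g\<close> and vanishes with
      it, so the relation on the support holds on all of \<open>R\<close>.\<close>
    have dzero: "(\<Sum>k\<in>S. d k * h k x) = 0" if "x \<in> R" for x
      using d(2) that by (cases "g x = 0") (auto simp: h_def)
    define D where "D = {k \<in> S. d k \<noteq> 0}"
    have D: "finite D" "D \<noteq> {}" using finS d(1) by (auto simp: D_def)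
    obtain k0 where k0: "k0 \<in> D" and k0_max: "\<And>k. k \<in> D \<Longrightarrow> k \<noteq> k0 \<Longrightarrow> lt k k0"
      using additive_total_order_min(2)[OF ord D] by blast
    define I where "I = S \<times> red_set q lt P"
    define e where "e = (\<lambda>(k, m). d k * c m)"
    define a where "a = (\<lambda>(k, m). m + (k - m0))"
    have finI: "finite I" using finS P.finite_red_set by (simp add: I_def)
    have aL: "a i \<in> lattice_points P'" if "i \<in> I" for i
      using that shift_mem by (auto simp: I_def a_def)
    have "(\<Sum>\<kappa>\<in>red_set CARD('k) lt P'. (\<Sum>i | i \<in> I \<and> red_point CARD('k) lt P' (a i) = \<kappa>. e i)
        * section_value P P' \<kappa> x) = 0" if x: "x \<in> R" for x
    proof -
      have "0 = (\<Sum>k\<in>S. d k * h k x)" using dzero[OF x] by simp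
      also have "\<dots> = (\<Sum>k\<in>S. \<Sum>m\<in>red_set q lt P. d k * c m * section_value P P' (m + (k - m0)) x)"
        by (intro sum.cong refl) (simp add: h sum_distrib_left mult.assoc)
      also have "\<dots> = (\<Sum>i\<in>I. e i * section_value P P' (a i) x)"
        by (simp add: I_def e_def a_def sum.cartesian_product case_prod_beta)
      also have "\<dots> = (\<Sum>\<kappa>\<in>red_set CARD('k) lt P'. (\<Sum>i | i \<in> I \<and> red_point CARD('k) lt P' (a i) = \<kappa>. e i)
        * section_value P P' \<kappa> x)"
        by (rule P'.sum_reduce[OF R(1) x ord finI aL])
      finally show ?thesis by simp
    qed
    moreover have k0_red: "k0 \<in> red_set q lt P'" using k0 by (auto simp: D_def S_def)
    ultimately have "(\<Sum>i | i \<in> I \<and> red_point q lt P' (a i) = k0. e i) = 0"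
      unfolding q_def by (rule P'.red_set_linearly_independent[OF R(1) ord])
    \<comment> \<open>A pair (k, m) with nonzero coefficient that reduces to k0 satisfies k0 \<le> m
      + (k - m0) \<le> k \<le> k0. Equality throughout leaves only (k0, m0), and that pair does
      reduce to k0 because k0 is reduced.\<close>
    also have "(\<Sum>i | i \<in> I \<and> red_point q lt P' (a i) = k0. e i) = (\<Sum>i\<in>{(k0, m0)}. e i)"
    proof (intro sum.mono_neutral_right ballI)
      show "finite {i. i \<in> I \<and> red_point q lt P' (a i) = k0}" using finI by simp
      show "{(k0, m0)} \<subseteq> {i. i \<in> I \<and> red_point q lt P' (a i) = k0}"
        using k0 m0 P'.red_point_fixed[OF ord k0_red] by (auto simp: I_def D_def M_def a_def)
      fix i assume i: "i \<in> {i. i \<in> I \<and> red_point q lt P' (a i) = k0} - {(k0, m0)}"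
      obtain k m where km: "i = (k, m)" by (cases i)
      show "e i = 0"
      proof (rule ccontr)
        assume "e i \<noteq> 0"
        then have "k \<in> D" "m \<in> M" using i by (auto simp: km e_def D_def M_def I_def)
        have le: "k0 = a i \<or> lt k0 (a i)"
          using P'.red_point_le[OF ord aL, of i q] i by auto
        have 1: "m = m0 \<or> lt (a i) k"
          using lt_add[OF m0_max[OF \<open>m \<in> M\<close>], of "k - m0"] by (auto simp: km a_def algebra_simps)
        have 2: "k = k0 \<or> lt k k0" using k0_max[OF \<open>k \<in> D\<close>] by blast
        show False
        proof (cases "m = m0")
          case True
          then have "a i = k" by (simp add: km a_def)
          moreover have "k \<noteq> k0" using True i km by auto
          ultimately show False using le 2 trans irrefl by metis
        next
          case False
          then show False using 1 2 le trans irrefl by metis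
        qed
      qed
    qed
    also have "\<dots> \<noteq> 0" using k0 m0 by (simp add: e_def D_def M_def)
    finally show False by simp
  qed
  then show ?thesis using m0 by (intro bexI[of _ m0]) (auto simp: S_def M_def q_def)
qed

text \<open>The coefficient functions in \<open>section_space\<close> are arbitrary, but only their
  values at finitely many lattice points matter.\<close>

lemma finite_toric_code:
  fixes R :: "('n :: finite, 'k :: {field, finite}) coords set"
  assumes "finite (lattice_points P')"
  shows "finite (toric_code P P' R)"
proof -
  define F where "F c = (\<Sum>m \<in> lattice_points P'. Poly_Mapping.single (monomial_exponent P P' m) (c m :: 'k))" for c
  have "section_space P P' \<subseteq> F ` (lattice_points P' \<rightarrow>\<^sub>E UNIV)"
  proof
    fix f :: "('n, 'k) cox_poly" assume "f \<in> section_space P P'"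
    then obtain c where c: "f = F c" by (auto simp: section_space_def F_def)
    have "F c = F (restrict c (lattice_points P'))" unfolding F_def by (intro sum.cong) auto
    then show "f \<in> F ` (lattice_points P' \<rightarrow>\<^sub>E UNIV)"
      unfolding c by (intro image_eqI[of _ F "restrict c (lattice_points P')"]) simp_all
  qed
  moreover have "finite (F ` (lattice_points P' \<rightarrow>\<^sub>E UNIV))"
    using assms by (intro finite_imageI finite_PiE) auto
  ultimately show ?thesis unfolding toric_code_def using finite_subset by blast
qed

text \<open>Indicator functions of points embed \<open>R\<close> into the function space.\<close>

lemma finite_if_finite_PiE_UNIV:
  assumes "finite (R \<rightarrow>\<^sub>E (UNIV :: 'k :: zero_neq_one set))"
  shows "finite R"
proof -
  define \<delta> :: "'a \<Rightarrow> 'a \<Rightarrow> 'k" where "\<delta> x = (\<lambda>y\<in>R. if y = x then 1 else 0)" for x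
  have "inj_on \<delta> R"
  proof (rule inj_onI)
    fix x y assume "x \<in> R" "y \<in> R" "\<delta> x = \<delta> y"
    then have "\<delta> x x = \<delta> y x" by simp
    then show "x = y" using \<open>x \<in> R\<close> by (simp add: \<delta>_def split: if_splits)
  qed
  moreover have "\<delta> ` R \<subseteq> R \<rightarrow>\<^sub>E UNIV" by (auto simp: \<delta>_def)
  ultimately show ?thesis using assms finite_subset finite_imageD by metis
qed

theorem theorem5p2:
  fixes P Psurj :: "(real ^ 'n) set"
    and R :: "('n, 'k :: {field, finite}) coords set"
    and lt :: "int ^ 'n \<Rightarrow> int ^ 'n \<Rightarrow> bool"
  assumes "standing_assumptions P CHAR('k)"
    and "is_rep_set P R"
    and "surjective_polytope P R Psurj"
    and "additive_total_order lt"
  shows "minimum_distance R (toric_code P P R) \<ge>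
    Min ((\<lambda>m. card ({k. emb k \<in> (+) (emb m) ` difference_polytope P Psurj}
                     \<inter> red_set CARD('k) lt Psurj)) ` red_set CARD('k) lt P)"
    (is "_ \<ge> Min (?bound ` _)")
proof -
  interpret S: polytope_pair P Psurj "CHAR('k)"
    using assms(1,3) by unfold_locales (auto simp: surjective_polytope_def)
  interpret P: polytope_pair P P "CHAR('k)"
    using assms(1) S.lattice by unfold_locales auto
  \<comment> \<open>By surjectivity the full space of words is the code of \<open>Psurj\<close>,
    which is finite; this is how \<open>R\<close> is seen to be finite.\<close>
  have "finite (R \<rightarrow>\<^sub>E (UNIV :: 'k set))"
    using finite_toric_code[OF S.finite_lattice_points'] assms(3) by (metis surjective_polytope_def)
  then have finR: "finite R" by (rule finite_if_finite_PiE_UNIV)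
  define ev where "ev c x = (\<Sum>m\<in>lattice_points P. to_ac (c m) * section_value P P m x)"
    for c :: "int ^ 'n \<Rightarrow> 'k" and x
  have code: "toric_code P P R = range (\<lambda>c. \<lambda>x\<in>R. of_ac (ev c x))"
    unfolding toric_code_def section_space_def evaluation_def
    by (auto simp: eval_section[OF P.finite_facets P.finite_lattice_points'] ev_def image_def)
  \<comment> \<open>\<open>of_ac\<close> is meaningful only on the range of \<open>to_ac\<close>.
    All values lie there, so zeros of the codeword are zeros of the section.\<close>
  have of_ac_ev: "of_ac (ev c x) = 0 \<longleftrightarrow> ev c x = 0" if "x \<in> R" for c x
  proof -
    have "\<forall>m\<in>lattice_points P. \<exists>a. section_value P P m x = to_ac a"
      using P.section_value_in_range_to_ac[OF assms(2) that] by blast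
    then obtain a where "\<And>m. m \<in> lattice_points P \<Longrightarrow> section_value P P m x = to_ac (a m)"
      by metis
    then have "ev c x = to_ac (\<Sum>m\<in>lattice_points P. c m * a m)" by (simp add: ev_def to_ac_sum)
    then show ?thesis by simp
  qed
  define red where "red c k = (\<Sum>m | m \<in> lattice_points P \<and> red_point CARD('k) lt P m = k. to_ac (c m))"
    for c :: "int ^ 'n \<Rightarrow> 'k" and k
  have ev_red: "ev c x = (\<Sum>k\<in>red_set CARD('k) lt P. red c k * section_value P P k x)" if "x \<in> R" for c x
    unfolding ev_def red_def
    by (rule P.sum_reduce[OF assms(2) that assms(4) P.finite_lattice_points', where g = "\<lambda>m. m"])
  \<comment> \<open>\<open>Min\<close> says something only about a nonempty set, so a nonzero
    codeword is needed. A reduced monomial gives one: by linear independence it does not vanish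
    identically on \<open>R\<close>.\<close>
  have nonzero: "toric_code P P R - {\<lambda>x\<in>R. 0} \<noteq> {}"
  proof -
    obtain v where "v extreme_point_of P" using polytope_minimizing_vertex[OF P.polytope P.nonempty] by blast
    then obtain m where "v = emb m" "v \<in> P"
      using extreme_point_lattice_polytope[OF P.lattice] extreme_point_of_def by metis
    then have "m \<in> lattice_points P" by (simp add: lattice_points_def)
    then have mr: "red_point CARD('k) lt P m \<in> red_set CARD('k) lt P" by (rule P.red_point_in_red_set)
    define k where "k = red_point CARD('k) lt P m"
    have k: "k \<in> red_set CARD('k) lt P" "k \<in> lattice_points P"
      using mr P.red_set_subset[OF assms(4)] by (auto simp: k_def)
    have "\<exists>x\<in>R. section_value P P k x \<noteq> 0"
    proof (rule ccontr)
      assume "\<not> ?thesis"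
      then have "(\<Sum>j\<in>red_set CARD('k) lt P. (if j = k then 1 else 0) * section_value P P j x) = 0"
        if "x \<in> R" for x
        using that by (intro sum.neutral) auto
      from P.red_set_linearly_independent[OF assms(2,4) this k(1)] show False by simp
    qed
    then obtain x where x: "x \<in> R" "section_value P P k x \<noteq> 0" by blast
    define c :: "int ^ 'n \<Rightarrow> 'k" where "c j = (if j = k then 1 else 0)" for j
    have "ev c x = (\<Sum>j\<in>lattice_points P. if j = k then section_value P P k x else 0)"
      unfolding ev_def by (intro sum.cong) (auto simp: c_def)
    also have "\<dots> = section_value P P k x" using k(2) P.finite_lattice_points' by simp
    finally have "of_ac (ev c x) \<noteq> 0" using x of_ac_ev[OF x(1), of c] by metis
    then have "(\<lambda>x\<in>R. of_ac (ev c x)) \<noteq> (\<lambda>x\<in>R. 0)" using x(1) by (metis restrict_apply')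
    then show ?thesis unfolding code by blast
  qed
  have "finite (hamming_weight R ` (toric_code P P R - {\<lambda>x\<in>R. 0}))"
    by (intro finite_imageI finite_Diff finite_toric_code P.finite_lattice_points')
  then have "minimum_distance R (toric_code P P R) \<in> hamming_weight R ` (toric_code P P R - {\<lambda>x\<in>R. 0})"
    unfolding minimum_distance_def using nonzero by (intro Min_in) auto
  then obtain c where c: "(\<lambda>x\<in>R. of_ac (ev c x)) \<noteq> (\<lambda>x\<in>R. 0)"
    and dist: "minimum_distance R (toric_code P P R) = hamming_weight R (\<lambda>x\<in>R. of_ac (ev c x))"
    unfolding code by auto
  have weight: "hamming_weight R (\<lambda>x\<in>R. of_ac (ev c x))
    = card {x \<in> R. (\<Sum>k\<in>red_set CARD('k) lt P. red c k * section_value P P k x) \<noteq> 0}"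
    unfolding hamming_weight_def
    by (rule arg_cong[of _ _ card]) (auto simp: of_ac_ev simp flip: ev_red)
  have "\<exists>k\<in>red_set CARD('k) lt P. red c k \<noteq> 0"
  proof (rule ccontr)
    assume "\<not> ?thesis"
    then have "ev c x = 0" if "x \<in> R" for x using that by (simp add: ev_red)
    then show False using c by (auto simp: restrict_def)
  qed
  then obtain m where m: "m \<in> red_set CARD('k) lt P"
    "?bound m \<le> minimum_distance R (toric_code P P R)"
    using weight_ge_shifted_red_set[OF P.polytope_pair_axioms S.polytope_pair_axioms assms(2) finR assms(4)]
    unfolding dist weight by blast
  have "Min (?bound ` red_set CARD('k) lt P) \<le> ?bound m"
    using m(1) P.finite_red_set by (intro Min_le) auto
  then show ?thesis using m(2) by linarith
qed

end
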